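(* Let $(\mathcal{S}^0,J)$ be an Inoue surface of type $\mathcal{S}^0$, i.e. $\mathcal{S}^0=(\mathbb{C}\times\mathbb{H})/G_A$ with the complex structure $J$ inherited from $\mathbb{C}\times\mathbb{H}$. The only possible Lee class of an LCK metric on $(\mathcal{S}^0,J)$ is $[\theta]\in H^1_{dR}(\mathcal{S}^0)$, where $\theta$ is the one-form induced by $\frac{dw_2}{w_2}$, $w_2=\operatorname{Im}w$ (the Lee form of Tricerri's metric). That is, if $g$ is an LCK metric on $(\mathcal{S}^0,J)$ with Lee form $\theta_1$, then $[\theta_1]=[\theta]$ in $H^1_{dR}(\mathcal{S}^0)$.
   Context: LCK metrics: a Hermitian metric $g$ on a complex manifold $(M,J)$, with fundamental two-form $\omega(X,Y)=g(JX,Y)$, is called locally conformally Kähler (LCK) if there is a closed one-form $\theta_1$ (its Lee form) with $d\omega=\theta_1\wedge\omega$. Its Lee class is $[\theta_1]\in H^1_{dR}(M)$. Inoue surface $\mathcal{S}^0$: let $A\in \mathrm{SL}_3(\mathbb{Z})$ have one real eigenvalue $\alpha>1$ and two complex (non-real) eigenvalues $\beta,\bar\beta$. Let $(a_1,a_2,a_3)^t$ be a real eigenvector for $\alpha$ and $(b_1,b_2,b_3)^t$ a complex eigenvector for $\beta$. Let $\mathbb{H}$ be the upper half-plane and $G_A$ the group of transformations of $\mathbb{C}\times\mathbb{H}$ (coordinates $(z,w)$) generated by $(z,w)\mapsto(\beta z,\alpha w)$ and $(z,w)\mapsto(z+b_i,w+a_i)$, $i=1,2,3$. Then $\mathcal{S}^0=(\mathbb{C}\times\mathbb{H})/G_A$,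 a compact complex surface. Tricerri's metric is the LCK metric on $\mathcal{S}^0$ induced by the $G_A$-invariant metric on $\mathbb{C}\times\mathbb{H}$ whose fundamental form is, up to sign convention, $\mathrm{i}\left(\frac{dw\wedge d\bar w}{w_2^2}+w_2\,dz\wedge d\bar z\right)$; its Lee form is $\theta$. *)

theory Defs
  imports
    "HOL-Analysis.Analysis"
    "HOL-Algebra.Bij"
    "HOL-Algebra.Generated_Groups"
    "HOL-Algebra.Group_Action"
begin

section \<open>Smooth functions on open sets\<close>

text \<open>
  Only meant for open \<open>S\<close>: all iterated directional derivatives exist as Frechet derivatives
  and are continuous on \<open>S\<close>.
\<close>

fun Ck_on :: "nat \<Rightarrow> ('e::euclidean_space \<Rightarrow> real) \<Rightarrow> 'e set \<Rightarrow> bool" where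
  "Ck_on 0 f S \<longleftrightarrow> continuous_on S f"
| "Ck_on (Suc k) f S \<longleftrightarrow>
     (\<forall>x\<in>S. f differentiable (at x)) \<and>
     (\<forall>v. Ck_on k (\<lambda>x. frechet_derivative f (at x) v) S)"

definition smooth_on :: "('e::euclidean_space \<Rightarrow> real) \<Rightarrow> 'e set \<Rightarrow> bool" where
  "smooth_on f S \<longleftrightarrow> (\<forall>k. Ck_on k f S)"


section \<open>Charts and complex surfaces\<close>

text \<open>
  A chart \<open>c\<close> is its domain \<open>fst c\<close> together with its coordinate map \<open>snd c\<close>, whose values
  outside the domain are irrelevant.
\<close>

type_synonym ('p, 'e) chart = "'p set \<times> ('p \<Rightarrow> 'e)"

definition chart_range :: "('p, 'e) chart \<Rightarrow> 'e set" where
  "chart_range c = snd c ` fst c"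

definition chart_inv :: "('p, 'e) chart \<Rightarrow> 'e \<Rightarrow> 'p" where
  "chart_inv c = inv_into (fst c) (snd c)"

definition overlap :: "('p, 'e) chart \<Rightarrow> ('p, 'e) chart \<Rightarrow> 'e set" where
  "overlap c d = snd c ` (fst c \<inter> fst d)"

definition transition :: "('p, 'e) chart \<Rightarrow> ('p, 'e) chart \<Rightarrow> 'e \<Rightarrow> 'e" where
  "transition c d = snd d \<circ> chart_inv c"

abbreviation transition_deriv ::
  "('p, 'e::euclidean_space) chart \<Rightarrow> ('p, 'e) chart \<Rightarrow> 'e \<Rightarrow> 'e \<Rightarrow> 'e" where
  "transition_deriv c d x \<equiv> frechet_derivative (transition c d) (at x)"

text \<open>Multiplication by the imaginary unit on \<open>\<complex>\<^sup>2\<close>.\<close>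

definition J :: "complex \<times> complex \<Rightarrow> complex \<times> complex" where
  "J v = (\<i> * fst v, \<i> * snd v)"

text \<open>
  Transition maps are holomorphic, i.e. real differentiable with complex linear derivative. Hence
  the endomorphism that is \<open>J\<close> in every chart is well defined: it is the complex structure of
  the surface.
\<close>

definition complex_atlas :: "'p set \<Rightarrow> ('p, complex \<times> complex) chart set \<Rightarrow> bool" where
  "complex_atlas M \<A> \<longleftrightarrow>
     (\<Union>c\<in>\<A>. fst c) = M \<and>
     (\<forall>c\<in>\<A>. inj_on (snd c) (fst c) \<and> open (chart_range c)) \<and>
     (\<forall>c\<in>\<A>. \<forall>d\<in>\<A>. open (overlap c d) \<and>
        (\<forall>x\<in>overlap c d. transition c d differentiable (at x) \<and>
           (\<forall>v. transition_deriv c d x (J v) = J (transition_deriv c d x v))))"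


section \<open>Functions, forms and metrics on a manifold\<close>

text \<open>
  A tensor field is given by its coordinate expressions: one for each chart, defined on the range
  of that chart, and related on overlaps by the derivative of the transition map. A field of
  covariant 1- or 2-tensors thus has type \<open>chart \<Rightarrow> point \<Rightarrow> vector \<Rightarrow> real\<close> or
  \<open>chart \<Rightarrow> point \<Rightarrow> vector \<Rightarrow> vector \<Rightarrow> real\<close>.
\<close>

type_synonym ('p, 'e) field1 = "('p, 'e) chart \<Rightarrow> 'e \<Rightarrow> 'e \<Rightarrow> real"
type_synonym ('p, 'e) field2 = "('p, 'e) chart \<Rightarrow> 'e \<Rightarrow> 'e \<Rightarrow> 'e \<Rightarrow> real"

definition smooth_function ::
  "('p, 'e::euclidean_space) chart set \<Rightarrow> ('p \<Rightarrow> real) \<Rightarrow> bool" where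
  "smooth_function \<A> f \<longleftrightarrow> (\<forall>c\<in>\<A>. smooth_on (f \<circ> chart_inv c) (chart_range c))"

definition one_form ::
  "('p, 'e::euclidean_space) chart set \<Rightarrow> ('p, 'e) field1 \<Rightarrow> bool" where
  "one_form \<A> \<eta> \<longleftrightarrow>
     (\<forall>c\<in>\<A>. (\<forall>x\<in>chart_range c. linear (\<eta> c x)) \<and>
            (\<forall>v. smooth_on (\<lambda>x. \<eta> c x v) (chart_range c))) \<and>
     (\<forall>c\<in>\<A>. \<forall>d\<in>\<A>. \<forall>x\<in>overlap c d. \<forall>v.
        \<eta> c x v = \<eta> d (transition c d x) (transition_deriv c d x v))"

definition bilinear_field ::
  "('p, 'e::euclidean_space) chart set \<Rightarrow> ('p, 'e) field2 \<Rightarrow> bool" where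
  "bilinear_field \<A> g \<longleftrightarrow>
     (\<forall>c\<in>\<A>. (\<forall>x\<in>chart_range c. bilinear (g c x)) \<and>
            (\<forall>u v. smooth_on (\<lambda>x. g c x u v) (chart_range c))) \<and>
     (\<forall>c\<in>\<A>. \<forall>d\<in>\<A>. \<forall>x\<in>overlap c d. \<forall>u v.
        g c x u v =
        g d (transition c d x) (transition_deriv c d x u) (transition_deriv c d x v))"

text \<open>
  Exterior derivatives of 0-, 1- and 2-forms on an open subset of a vector space, and the wedge
  product of a 1-form with a 2-form, normalised so that
  \<open>d(f \<omega>) = df \<and> \<omega> + f d\<omega>\<close>. Vectors are
  regarded as constant vector fields, so no bracket terms occur.
\<close>

definition ext_d0 :: "('e::euclidean_space \<Rightarrow> real) \<Rightarrow> 'e \<Rightarrow> 'e \<Rightarrow> real" where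
  "ext_d0 f x u = frechet_derivative f (at x) u"

definition ext_d1 :: "('e::euclidean_space \<Rightarrow> 'e \<Rightarrow> real) \<Rightarrow> 'e \<Rightarrow> 'e \<Rightarrow> 'e \<Rightarrow> real" where
  "ext_d1 \<eta> x u v =
     frechet_derivative (\<lambda>y. \<eta> y v) (at x) u - frechet_derivative (\<lambda>y. \<eta> y u) (at x) v"

definition ext_d2 ::
  "('e::euclidean_space \<Rightarrow> 'e \<Rightarrow> 'e \<Rightarrow> real) \<Rightarrow> 'e \<Rightarrow> 'e \<Rightarrow> 'e \<Rightarrow> 'e \<Rightarrow> real" where
  "ext_d2 \<omega> x u v w =
     frechet_derivative (\<lambda>y. \<omega> y v w) (at x) u
   - frechet_derivative (\<lambda>y. \<omega> y u w) (at x) v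
   + frechet_derivative (\<lambda>y. \<omega> y u v) (at x) w"

definition wedge12 ::
  "('e \<Rightarrow> real) \<Rightarrow> ('e \<Rightarrow> 'e \<Rightarrow> real) \<Rightarrow> 'e \<Rightarrow> 'e \<Rightarrow> 'e \<Rightarrow> real" where
  "wedge12 \<eta> \<omega> u v w = \<eta> u * \<omega> v w - \<eta> v * \<omega> u w + \<eta> w * \<omega> u v"

definition closed_one_form ::
  "('p, 'e::euclidean_space) chart set \<Rightarrow> ('p, 'e) field1 \<Rightarrow> bool" where
  "closed_one_form \<A> \<eta> \<longleftrightarrow>
     one_form \<A> \<eta> \<and> (\<forall>c\<in>\<A>. \<forall>x\<in>chart_range c. \<forall>u v. ext_d1 (\<eta> c) x u v = 0)"

text \<open>
  The class of \<open>\<eta>\<close> in \<open>H\<^sup>1\<^sub>d\<^sub>R\<close>: all closed 1-forms that differ from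
  \<open>\<eta>\<close> by the differential of a smooth function.
\<close>

definition deRham_class1 ::
  "('p, 'e::euclidean_space) chart set \<Rightarrow> ('p, 'e) field1 \<Rightarrow> ('p, 'e) field1 set" where
  "deRham_class1 \<A> \<eta> =
     {\<zeta>. closed_one_form \<A> \<zeta> \<and>
          (\<exists>f. smooth_function \<A> f \<and>
             (\<forall>c\<in>\<A>. \<forall>x\<in>chart_range c. \<forall>v.
                \<zeta> c x v - \<eta> c x v = ext_d0 (f \<circ> chart_inv c) x v))}"

definition hermitian_metric ::
  "('p, complex \<times> complex) chart set \<Rightarrow> ('p, complex \<times> complex) field2 \<Rightarrow> bool" where
  "hermitian_metric \<A> g \<longleftrightarrow>
     bilinear_field \<A> g \<and>
     (\<forall>c\<in>\<A>. \<forall>x\<in>chart_range c.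
        (\<forall>u v. g c x u v = g c x v u) \<and>
        (\<forall>u. u \<noteq> 0 \<longrightarrow> 0 < g c x u u) \<and>
        (\<forall>u v. g c x (J u) (J v) = g c x u v))"

definition fundamental_form ::
  "('p, complex \<times> complex) field2 \<Rightarrow> ('p, complex \<times> complex) field2" where
  "fundamental_form g c x u v = g c x (J u) v"

definition LCK_metric ::
  "('p, complex \<times> complex) chart set \<Rightarrow> ('p, complex \<times> complex) field2 \<Rightarrow>
   ('p, complex \<times> complex) field1 \<Rightarrow> bool" where
  "LCK_metric \<A> g \<eta> \<longleftrightarrow>
     hermitian_metric \<A> g \<and> closed_one_form \<A> \<eta> \<and>
     (\<forall>c\<in>\<A>. \<forall>x\<in>chart_range c. \<forall>u v w.
        ext_d2 (fundamental_form g c) x u v w =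
        wedge12 (\<eta> c x) (fundamental_form g c x) u v w)"


section \<open>Inoue surfaces of type S0\<close>

text \<open>
  As \<open>A\<close> is a real matrix, the conjugate of \<open>\<beta>\<close> is an eigenvalue as well, so
  \<open>\<alpha>\<close>, \<open>\<beta>\<close> and the conjugate of \<open>\<beta>\<close> are all the eigenvalues of \<open>A\<close>.
\<close>

definition inoue_data ::
  "int^3^3 \<Rightarrow> real \<Rightarrow> complex \<Rightarrow> real^3 \<Rightarrow> complex^3 \<Rightarrow> bool" where
  "inoue_data A \<alpha> \<beta> a b \<longleftrightarrow>
     det A = 1 \<and> 1 < \<alpha> \<and> \<beta> \<notin> \<real> \<and>
     a \<noteq> 0 \<and> map_matrix of_int A *v a = \<alpha> *s a \<and>
     b \<noteq> 0 \<and> map_matrix of_int A *v b = \<beta> *s b"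

definition CH :: "(complex \<times> complex) set" where
  "CH = UNIV \<times> {w. 0 < Im w}"

definition inoue_generators ::
  "real \<Rightarrow> complex \<Rightarrow> real^3 \<Rightarrow> complex^3 \<Rightarrow>
   (complex \<times> complex \<Rightarrow> complex \<times> complex) set" where
  "inoue_generators \<alpha> \<beta> a b =
     insert (\<lambda>(z, w)\<in>CH. (\<beta> * z, of_real \<alpha> * w))
       (range (\<lambda>i. \<lambda>(z, w)\<in>CH. (z + b $ i, w + of_real (a $ i))))"

definition inoue_group ::
  "real \<Rightarrow> complex \<Rightarrow> real^3 \<Rightarrow> complex^3 \<Rightarrow>
   (complex \<times> complex \<Rightarrow> complex \<times> complex) monoid" where
  "inoue_group \<alpha> \<beta> a b =
     (BijGroup CH)\<lparr>carrier := generate (BijGroup CH) (inoue_generators \<alpha> \<beta> a b)\<rparr>"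

definition inoue_proj ::
  "real \<Rightarrow> complex \<Rightarrow> real^3 \<Rightarrow> complex^3 \<Rightarrow> complex \<times> complex \<Rightarrow> (complex \<times> complex) set" where
  "inoue_proj \<alpha> \<beta> a b = orbit (inoue_group \<alpha> \<beta> a b) (\<lambda>g. g)"

definition inoue_surface ::
  "real \<Rightarrow> complex \<Rightarrow> real^3 \<Rightarrow> complex^3 \<Rightarrow> (complex \<times> complex) set set" where
  "inoue_surface \<alpha> \<beta> a b = orbits (inoue_group \<alpha> \<beta> a b) CH (\<lambda>g. g)"

text \<open>
  The charts of the quotient are the inverses of the restrictions of the projection to those open
  subsets of \<open>\<complex> \<times> \<bbbH>\<close> on which it is injective.
\<close>

definition inoue_atlas ::
  "real \<Rightarrow> complex \<Rightarrow> real^3 \<Rightarrow> complex^3 \<Rightarrow>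
   ((complex \<times> complex) set, complex \<times> complex) chart set" where
  "inoue_atlas \<alpha> \<beta> a b =
     {(inoue_proj \<alpha> \<beta> a b ` U, inv_into U (inoue_proj \<alpha> \<beta> a b)) | U.
        open U \<and> U \<subseteq> CH \<and> inj_on (inoue_proj \<alpha> \<beta> a b) U}"

text \<open>
  The coordinates of every chart of \<open>inoue_atlas\<close> are the coordinates \<open>(z, w)\<close> of
  \<open>\<complex> \<times> \<bbbH>\<close>, so the form induced by \<open>dw\<^sub>2/w\<^sub>2\<close> with
  \<open>w\<^sub>2 = Im w\<close> has the same expression in all of them.
\<close>

definition inoue_theta :: "((complex \<times> complex) set, complex \<times> complex) field1" where
  "inoue_theta c x v = Im (snd v) / Im (snd x)"


section \<open>The atlas makes the Inoue surface a complex surface\<close>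

text \<open>
  The action of \<open>inoue_group\<close> is free and properly discontinuous: its elements are the maps
  \<open>(z, w) \<mapsto> (\<beta>\<^sup>k z + s, \<alpha>\<^sup>k w + t)\<close> with \<open>(s, t)\<close> in the
  \<open>\<int>\<close>-span of the pairs \<open>(b\<^sub>i, a\<^sub>i)\<close>, which is a lattice in
  \<open>\<complex> \<times> \<real>\<close>.
\<close>

definition inoue_aff :: "real \<Rightarrow> complex \<Rightarrow> int \<Rightarrow> complex \<Rightarrow> real \<Rightarrow> complex \<times> complex \<Rightarrow> complex \<times> complex" where
  "inoue_aff \<alpha> \<beta> k s t = (\<lambda>(z, w). (\<beta> powi k * z + s, of_real (\<alpha> powi k) * w + of_real t))"

definition inoue_lattice :: "real^3 \<Rightarrow> complex^3 \<Rightarrow> (complex \<times> real) set" where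
  "inoue_lattice a b = range (\<lambda>n :: int^3. (\<Sum>i\<in>UNIV. of_int (n $ i) * b $ i, \<Sum>i\<in>UNIV. of_int (n $ i) * a $ i))"

lemma inoue_lattice_0: "(0, 0) \<in> inoue_lattice a b"
  unfolding inoue_lattice_def by (rule range_eqI[where x=0]) simp

lemma inoue_lattice_add: "x \<in> inoue_lattice a b \<Longrightarrow> y \<in> inoue_lattice a b \<Longrightarrow> x + y \<in> inoue_lattice a b"
proof -
  assume "x \<in> inoue_lattice a b" "y \<in> inoue_lattice a b"
  then obtain n m :: "int^3" where
    "x = (\<Sum>i\<in>UNIV. of_int (n $ i) * b $ i, \<Sum>i\<in>UNIV. of_int (n $ i) * a $ i)"
    "y = (\<Sum>i\<in>UNIV. of_int (m $ i) * b $ i, \<Sum>i\<in>UNIV. of_int (m $ i) * a $ i)"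
    unfolding inoue_lattice_def by blast
  then show ?thesis unfolding inoue_lattice_def
    by (intro range_eqI[where x="n+m"]) (simp add: algebra_simps sum.distrib)
qed

lemma inoue_lattice_scale: "x \<in> inoue_lattice a b \<Longrightarrow> (of_int m * fst x, of_int m * snd x) \<in> inoue_lattice a b"
proof -
  assume "x \<in> inoue_lattice a b"
  then obtain n :: "int^3" where
    "x = (\<Sum>i\<in>UNIV. of_int (n $ i) * b $ i, \<Sum>i\<in>UNIV. of_int (n $ i) * a $ i)"
    unfolding inoue_lattice_def by blast
  then show ?thesis unfolding inoue_lattice_def
    by (intro range_eqI[where x="\<chi> i. m * n $ i"]) (simp add: algebra_simps sum_distrib_left)
qed

context
  fixes A \<alpha> \<beta> a b
  assumes D: "inoue_data A \<alpha> \<beta> a b"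
begin

lemma eig_a: "(\<Sum>j\<in>UNIV. of_int (A $ i $ j) * a $ j) = \<alpha> * a $ i"
proof -
  have "(map_matrix of_int A *v a) $ i = (\<alpha> *s a) $ i" using D unfolding inoue_data_def by metis
  then show ?thesis by (simp add: matrix_vector_mult_def)
qed
lemma eig_b: "(\<Sum>j\<in>UNIV. of_int (A $ i $ j) * b $ j) = \<beta> * b $ i"
proof -
  have "(map_matrix of_int A *v b) $ i = (\<beta> *s b) $ i" using D unfolding inoue_data_def by metis
  then show ?thesis by (simp add: matrix_vector_mult_def)
qed

lemma inoue_lattice_mult: "(s, t) \<in> inoue_lattice a b \<Longrightarrow> (\<beta> * s, \<alpha> * t) \<in> inoue_lattice a b"
proof -
  assume "(s, t) \<in> inoue_lattice a b"
  then obtain n :: "int^3" where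
    n: "s = (\<Sum>i\<in>UNIV. of_int (n $ i) * b $ i)" "t = (\<Sum>i\<in>UNIV. of_int (n $ i) * a $ i)"
    unfolding inoue_lattice_def by blast
  have "\<beta> * s = (\<Sum>i\<in>UNIV. of_int (n $ i) * (\<beta> * b $ i))"
    by (simp add: n sum_distrib_left algebra_simps)
  also have "\<dots> = (\<Sum>j\<in>UNIV. of_int (\<Sum>i\<in>UNIV. n $ i * A $ i $ j) * b $ j)"
    unfolding eig_b[symmetric] of_int_sum of_int_mult sum_distrib_left sum_distrib_right
    by (subst sum.swap) (simp add: algebra_simps)
  finally have 1: "\<beta> * s = \<dots>" .
  have "\<alpha> * t = (\<Sum>i\<in>UNIV. of_int (n $ i) * (\<alpha> * a $ i))"
    by (simp add: n sum_distrib_left algebra_simps)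
  also have "\<dots> = (\<Sum>j\<in>UNIV. of_int (\<Sum>i\<in>UNIV. n $ i * A $ i $ j) * a $ j)"
    unfolding eig_a[symmetric] of_int_sum of_int_mult sum_distrib_left sum_distrib_right
    by (subst sum.swap) (simp add: algebra_simps)
  finally have 2: "\<alpha> * t = \<dots>" .
  show ?thesis unfolding inoue_lattice_def
    by (rule range_eqI[where x="\<chi> j. \<Sum>i\<in>UNIV. n $ i * A $ i $ j"]) (simp add: 1 2)
qed

definition "inoue_tr1 = A$1$1 + A$2$2 + A$3$3"
definition "inoue_tr2 = A$1$1*A$2$2 - A$1$2*A$2$1 + A$1$1*A$3$3 - A$1$3*A$3$1 + A$2$2*A$3$3 - A$2$3*A$3$2"

lemma inoue_det: "det A = 1" using D unfolding inoue_data_def by auto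

lemma char_poly:
  fixes v :: "'a::field_char_0^3" and x :: 'a
  assumes e: "\<And>i. (\<Sum>j\<in>UNIV. of_int (A $ i $ j) * v $ j) = x * v $ i" and "v \<noteq> 0"
  shows "x * (x * x - of_int inoue_tr1 * x + of_int inoue_tr2) = 1"
proof -
  define B where "B = (map_matrix of_int A - mat x :: 'a^3^3)"
  have "B *v v = 0"
  proof -
    have "B $ i $ j * v $ j = of_int (A $ i $ j) * v $ j - (if i = j then x * v $ j else 0)" for i j
      by (simp add: B_def mat_def algebra_simps)
    then show ?thesis
      using e by (simp add: vec_eq_iff matrix_vector_mult_def sum_subtractf)
  qed
  then have "det B = 0"
    using \<open>v \<noteq> 0\<close> by (metis invertible_det_nz invertible_left_inverse matrix_left_invertible_ker)
  then have 1: "x * (x * x - of_int inoue_tr1 * x + of_int inoue_tr2) = of_int (det A)"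
    unfolding det_3 B_def inoue_tr1_def inoue_tr2_def by (simp add: mat_def algebra_simps)
  then show ?thesis by (simp add: inoue_det)
qed

lemma eigvec_a_nonzero: "a \<noteq> 0" and eigvec_b_nonzero: "b \<noteq> 0" and alpha_gt_1: "\<alpha> > 1" and beta_nonreal: "\<beta> \<notin> \<real>"
  using D unfolding inoue_data_def by auto

lemma beta_nonzero: "\<beta> \<noteq> 0" using beta_nonreal by auto

lemma inoue_lattice_div: "(s, t) \<in> inoue_lattice a b \<Longrightarrow> (s / \<beta>, t / \<alpha>) \<in> inoue_lattice a b"
proof -
  assume st: "(s, t) \<in> inoue_lattice a b"
  have i1: "1 / \<beta> = \<beta> * \<beta> - of_int inoue_tr1 * \<beta> + of_int inoue_tr2"
    using char_poly[OF eig_b eigvec_b_nonzero] beta_nonzero by (simp add: divide_eq_eq mult.commute)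
  have i2: "1 / \<alpha> = \<alpha> * \<alpha> - of_int inoue_tr1 * \<alpha> + of_int inoue_tr2"
    using char_poly[OF eig_a eigvec_a_nonzero] alpha_gt_1 by (simp add: divide_eq_eq mult.commute)
  note m1 = inoue_lattice_mult[OF st] note m2 = inoue_lattice_mult[OF m1]
  have "(\<beta> * (\<beta> * s), \<alpha> * (\<alpha> * t)) + (of_int (- inoue_tr1) * (\<beta> * s), of_int (- inoue_tr1) * (\<alpha> * t))
      + (of_int inoue_tr2 * s, of_int inoue_tr2 * t) \<in> inoue_lattice a b"
    using inoue_lattice_add[OF inoue_lattice_add[OF m2 inoue_lattice_scale[OF m1, of "- inoue_tr1"]] inoue_lattice_scale[OF st, of inoue_tr2]] by simp
  moreover have "\<beta> * (\<beta> * s) + of_int (- inoue_tr1) * (\<beta> * s) + of_int inoue_tr2 * s = s * (1 / \<beta>)"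
    unfolding i1 by (simp add: algebra_simps)
  moreover have "\<alpha> * (\<alpha> * t) + of_int (- inoue_tr1) * (\<alpha> * t) + of_int inoue_tr2 * t = t * (1 / \<alpha>)"
    unfolding i2 by (simp add: algebra_simps)
  ultimately show ?thesis by simp
qed

lemma inoue_lattice_powi: "(s, t) \<in> inoue_lattice a b \<Longrightarrow> (\<beta> powi k * s, \<alpha> powi k * t) \<in> inoue_lattice a b"
proof (induction k arbitrary: s t rule: int_induct[where k=0])
  case base then show ?case by simp
next
  case (step1 i)
  from inoue_lattice_mult[OF step1(2)[OF step1(3)]] show ?case
    using beta_nonzero alpha_gt_1 by (simp add: power_int_add_1' mult.assoc)
next
  case (step2 i)
  from inoue_lattice_div[OF step2(2)[OF step2(3)]] show ?case
    using beta_nonzero alpha_gt_1 by (simp add: power_int_diff)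
qed

lemma eig_indep:
  fixes x :: "real^3"
  assumes xa: "(\<Sum>i\<in>UNIV. x $ i * a $ i) = 0" and xb: "(\<Sum>i\<in>UNIV. of_real (x $ i) * b $ i) = 0"
  shows "x = 0"
proof -
  define C :: "complex^3^3" where "C = (\<chi> i. if i = 1 then (\<chi> j. of_real (a $ j)) else if i = 2 then b else (\<chi> j. cnj (b $ j)))"
  have xc: "(\<Sum>i\<in>UNIV. of_real (x $ i) * cnj (b $ i)) = 0"
    using arg_cong[OF xb, of cnj] by simp
  have xa': "(\<Sum>i\<in>UNIV. of_real (x $ i) * complex_of_real (a $ i)) = 0"
    using arg_cong[OF xa, of complex_of_real] by simp
  have Cx: "C *v (\<chi> i. of_real (x $ i)) = 0"
    using xa' xb xc exhaust_3
    by (auto simp: vec_eq_iff matrix_vector_mult_def C_def mult.commute)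
  have "v = 0" if v: "v v* C = 0" for v :: "complex^3"
  proof -
    have 0: "v$1 * of_real (a$j) + v$2 * b$j + v$3 * cnj (b$j) = 0" for j
      using v by (simp add: vec_eq_iff vector_matrix_mult_def C_def sum_3 mult.commute)
    have ca: "(\<Sum>j\<in>UNIV. of_int (A $ i $ j) * complex_of_real (a $ j)) = \<alpha> * of_real (a $ i)" for i
      using arg_cong[OF eig_a[of i], of complex_of_real] by simp
    have cb: "(\<Sum>j\<in>UNIV. of_int (A $ i $ j) * cnj (b $ j)) = cnj \<beta> * cnj (b $ i)" for i
      using arg_cong[OF eig_b[of i], of cnj] by simp
    have st: "p * \<alpha> * of_real (a$j) + q * \<beta> * b$j + r * cnj \<beta> * cnj (b$j) = 0"
      if "\<And>j. p * of_real (a$j) + q * b$j + r * cnj (b$j) = 0" for p q r j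
    proof -
      have "(\<Sum>k\<in>UNIV. of_int (A $ j $ k) * (p * of_real (a$k) + q * b$k + r * cnj (b$k))) = 0"
        using that by simp
      also have "(\<Sum>k\<in>UNIV. of_int (A $ j $ k) * (p * of_real (a$k) + q * b$k + r * cnj (b$k)))
        = p * (\<Sum>k\<in>UNIV. of_int (A $ j $ k) * of_real (a$k)) + q * (\<Sum>k\<in>UNIV. of_int (A $ j $ k) * b$k)
          + r * (\<Sum>k\<in>UNIV. of_int (A $ j $ k) * cnj (b$k))"
        by (simp add: sum_distrib_left sum.distrib algebra_simps)
      finally show ?thesis unfolding ca cb eig_b by (simp add: algebra_simps)
    qed
    note 1 = st[OF 0]
    note 2 = st[OF 1]
    have nb: "\<beta> \<noteq> cnj \<beta>" using beta_nonreal by (metis Reals_cnj_iff)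
    have na: "\<beta> \<noteq> of_real \<alpha>" "cnj \<beta> \<noteq> of_real \<alpha>"
      using beta_nonreal by (metis Reals_of_real, metis Reals_of_real complex_cnj_complex_of_real complex_cnj_cnj)
    have p: "v$1 * ((of_real \<alpha> - \<beta>) * (of_real \<alpha> - cnj \<beta>)) * of_real (a$j) = 0" for j
      using 0[of j] 1[of j] 2[of j] by algebra
    have q: "v$2 * ((\<beta> - of_real \<alpha>) * (\<beta> - cnj \<beta>)) * b$j = 0" for j
      using 0[of j] 1[of j] 2[of j] by algebra
    have r: "v$3 * ((cnj \<beta> - of_real \<alpha>) * (cnj \<beta> - \<beta>)) * cnj (b$j) = 0" for j
      using 0[of j] 1[of j] 2[of j] by algebra
    obtain ja where ja: "a$ja \<noteq> 0" using eigvec_a_nonzero by (auto simp: vec_eq_iff)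
    obtain jb where jb: "b$jb \<noteq> 0" using eigvec_b_nonzero by (auto simp: vec_eq_iff)
    have "v$1 = 0" using p[of ja] ja na by auto
    moreover have "v$2 = 0" using q[of jb] jb na nb by auto
    moreover have "v$3 = 0" using r[of jb] jb na nb by auto
    ultimately show ?thesis using exhaust_3 by (metis vec_eq_iff zero_index)
  qed
  then have "invertible (transpose C)"
    by (simp add: invertible_left_inverse matrix_left_invertible_ker)
  then have "invertible C"
    by (metis det_transpose invertible_det_nz)
  then have "(\<chi> i. complex_of_real (x $ i)) = 0"
    using Cx by (meson invertible_left_inverse matrix_left_invertible_ker)
  then show ?thesis by (simp add: vec_eq_iff)
qed

lemma inoue_lattice_discrete: "\<exists>c>0. \<forall>(s,t)\<in>inoue_lattice a b. norm (s,t) < c \<longrightarrow> s = 0 \<and> t = 0"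
proof -
  define T :: "real^3 \<Rightarrow> complex \<times> real" where
    "T x = (\<Sum>i\<in>UNIV. of_real (x $ i) * b $ i, \<Sum>i\<in>UNIV. x $ i * a $ i)" for x
  have "linear T"
  proof (rule linearI)
    fix x y show "T (x + y) = T x + T y"
      by (simp add: T_def algebra_simps sum.distrib)
  next
    fix r :: real and x
    have "of_real ((r *\<^sub>R x) $ i) * b $ i = r *\<^sub>R (of_real (x $ i) * b $ i)" for i
      by (simp add: vector_scaleR_component) (simp add: scaleR_conv_of_real)
    moreover have "(r *\<^sub>R x) $ i * a $ i = r *\<^sub>R (x $ i * a $ i)" for i
      by (simp add: vector_scaleR_component)
    ultimately show "T (r *\<^sub>R x) = r *\<^sub>R T x"
      by (simp only: T_def scaleR_Pair scaleR_sum_right)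
  qed
  moreover have "inj T"
    unfolding linear_injective_0[OF \<open>linear T\<close>] using eig_indep by (auto simp: T_def zero_prod_def)
  ultimately obtain B where B: "B > 0" "\<And>x. B * norm x \<le> norm (T x)"
    using linear_inj_bounded_below_pos by blast
  show ?thesis
  proof (intro exI[of _ B] conjI ballI B(1), clarify)
    fix s t assume st: "(s, t) \<in> inoue_lattice a b" and lt: "norm (s, t) < B"
    then obtain n :: "int^3" where
      n: "s = (\<Sum>i\<in>UNIV. of_int (n $ i) * b $ i)" "t = (\<Sum>i\<in>UNIV. of_int (n $ i) * a $ i)"
      unfolding inoue_lattice_def by blast
    define x :: "real^3" where "x = (\<chi> i. of_int (n $ i))"
    have Tx: "T x = (s, t)" by (simp add: T_def x_def n)
    have "B * norm x < B" using B(2)[of x] lt Tx by simp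
    then have nx: "norm x < 1" using B(1) by simp
    have "n $ i = 0" for i
    proof -
      have "\<bar>x $ i\<bar> < 1" using component_le_norm_cart[of x i] nx by linarith
      then show ?thesis by (simp add: x_def)
    qed
    then show "s = 0 \<and> t = 0" by (simp add: n)
  qed
qed

abbreviation "inoue_aff_map k s t \<equiv> restrict (inoue_aff \<alpha> \<beta> k s t) CH"

lemma inoue_aff_comp: "inoue_aff \<alpha> \<beta> k s t (inoue_aff \<alpha> \<beta> l s' t' p) =
    inoue_aff \<alpha> \<beta> (k + l) (\<beta> powi k * s' + s) (\<alpha> powi k * t' + t) p"
proof -
  have 1: "\<beta> powi (k + l) = \<beta> powi k * \<beta> powi l" "\<alpha> powi (k + l) = \<alpha> powi k * \<alpha> powi l"
    using beta_nonzero alpha_gt_1 by (simp_all add: power_int_add)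
  show ?thesis
    by (cases p) (simp add: inoue_aff_def 1 distrib_left mult.assoc add.assoc)
qed

lemma inoue_aff_0: "inoue_aff \<alpha> \<beta> 0 0 0 p = p"
  by (cases p) (simp add: inoue_aff_def)

lemma inoue_aff_CH: "p \<in> CH \<Longrightarrow> inoue_aff \<alpha> \<beta> k s t p \<in> CH"
proof -
  assume "p \<in> CH"
  then have 1: "0 < Im (snd p)" by (auto simp: CH_def)
  have "Im (snd (inoue_aff \<alpha> \<beta> k s t p)) = \<alpha> powi k * Im (snd p)"
    unfolding inoue_aff_def split_beta snd_conv by (simp del: of_real_power_int)
  moreover have "0 < \<alpha> powi k * Im (snd p)" using 1 alpha_gt_1 by simp
  ultimately show ?thesis unfolding CH_def by (simp add: mem_Times_iff)
qed

lemma inoue_aff_inv1: "inoue_aff \<alpha> \<beta> (-k) (-(\<beta> powi (-k) * s)) (-(\<alpha> powi (-k) * t)) (inoue_aff \<alpha> \<beta> k s t p) = p"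
  by (simp add: inoue_aff_comp inoue_aff_0)

lemma inoue_aff_inv2: "inoue_aff \<alpha> \<beta> k s t (inoue_aff \<alpha> \<beta> (-k) (-(\<beta> powi (-k) * s)) (-(\<alpha> powi (-k) * t)) p) = p"
proof -
  have "\<beta> powi k * \<beta> powi (-k) = 1" "\<alpha> powi k * \<alpha> powi (-k) = 1"
    using beta_nonzero alpha_gt_1 by (simp_all add: power_int_minus)
  then have "\<beta> powi k * (\<beta> powi (-k) * s) = s" "\<alpha> powi k * (\<alpha> powi (-k) * t) = t"
    by (metis mult.assoc mult_1)+
  then show ?thesis unfolding inoue_aff_comp mult_minus_right by (simp only: add.left_inverse add.right_inverse inoue_aff_0)
qed

lemma inoue_aff_map_Bij: "inoue_aff_map k s t \<in> Bij CH"
  unfolding Bij_def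
proof (intro IntI CollectI)
  show "bij_betw (inoue_aff_map k s t) CH CH"
    by (rule bij_betw_byWitness[where f'="inoue_aff \<alpha> \<beta> (-k) (-(\<beta> powi (-k) * s)) (-(\<alpha> powi (-k) * t))"])
      (auto simp: inoue_aff_inv1 inoue_aff_inv2 inoue_aff_CH)
qed simp

lemma inoue_aff_map_mult: "inoue_aff_map k s t \<otimes>\<^bsub>BijGroup CH\<^esub> inoue_aff_map l s' t' =
    inoue_aff_map (k + l) (\<beta> powi k * s' + s) (\<alpha> powi k * t' + t)"
  proof -
  have "inoue_aff_map k s t \<otimes>\<^bsub>BijGroup CH\<^esub> inoue_aff_map l s' t' = compose CH (inoue_aff_map k s t) (inoue_aff_map l s' t')"
    by (simp add: BijGroup_def inoue_aff_map_Bij)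
  also have "\<dots> = inoue_aff_map (k + l) (\<beta> powi k * s' + s) (\<alpha> powi k * t' + t)"
    unfolding compose_def by (rule restrict_ext) (simp only: restrict_apply inoue_aff_CH if_True inoue_aff_comp)
  finally show ?thesis .
qed

lemma inoue_aff_map_one: "\<one>\<^bsub>BijGroup CH\<^esub> = inoue_aff_map 0 0 0"
  unfolding BijGroup_def monoid.simps by (rule restrict_ext) (simp only: inoue_aff_0)

lemma inoue_aff_map_inv: "inv\<^bsub>BijGroup CH\<^esub> (inoue_aff_map k s t) = inoue_aff_map (-k) (-(\<beta> powi (-k) * s)) (-(\<alpha> powi (-k) * t))"
proof (rule group.inv_equality[OF group_BijGroup])
  show "inoue_aff_map (-k) (-(\<beta> powi (-k) * s)) (-(\<alpha> powi (-k) * t)) \<otimes>\<^bsub>BijGroup CH\<^esub> inoue_aff_map k s t = \<one>\<^bsub>BijGroup CH\<^esub>"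
    unfolding inoue_aff_map_mult inoue_aff_map_one by (simp only: add.right_inverse add.left_inverse)
qed (simp_all only: BijGroup_def partial_object.simps inoue_aff_map_Bij)

lemma inoue_lattice_basis: "(b $ i, a $ i) \<in> inoue_lattice a b"
proof -
  have *: "of_int (if j = i then 1 else 0) * x = (if j = i then x else 0)" for j and x :: "'a::ring_1"
    by simp
  show ?thesis unfolding inoue_lattice_def
  by (rule range_eqI[where x="\<chi> j. if j = i then 1 else 0"]) (simp add: * del: of_int_1 of_int_0)
qed

lemma inoue_lattice_uminus: "(s, t) \<in> inoue_lattice a b \<Longrightarrow> (-s, -t) \<in> inoue_lattice a b"
  using inoue_lattice_scale[of "(s, t)" a b "-1"] by simp

lemma gen_form_incl:
  assumes "h \<in> inoue_generators \<alpha> \<beta> a b"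
  shows "\<exists>k s t. (s, t) \<in> inoue_lattice a b \<and> h = inoue_aff_map k s t"
proof -
  consider "h = (\<lambda>(z, w)\<in>CH. (\<beta> * z, of_real \<alpha> * w))"
    | i where "h = (\<lambda>(z, w)\<in>CH. (z + b $ i, w + of_real (a $ i)))"
    using assms unfolding inoue_generators_def by auto
  then show ?thesis
  proof cases
    case 1
    then have "h = inoue_aff_map 1 0 0" by (simp add: inoue_aff_def)
    then show ?thesis using inoue_lattice_0 by blast
  next
    case 2
    then have "h = inoue_aff_map 0 (b $ i) (a $ i)" by (simp add: inoue_aff_def)
    then show ?thesis using inoue_lattice_basis by blast
  qed
qed

lemma gen_form:
  assumes "h \<in> generate (BijGroup CH) (inoue_generators \<alpha> \<beta> a b)"
  shows "\<exists>k s t. (s, t) \<in> inoue_lattice a b \<and> h = inoue_aff_map k s t"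
  using assms
proof induction
  case one
  then show ?case using inoue_lattice_0 inoue_aff_map_one by blast
next
  case (incl h)
  then show ?case by (rule gen_form_incl)
next
  case (inv h)
  then obtain k s t where st: "(s, t) \<in> inoue_lattice a b" and h: "h = inoue_aff_map k s t" using gen_form_incl by blast
  show ?case unfolding h inoue_aff_map_inv using inoue_lattice_uminus[OF inoue_lattice_powi[OF st]] by blast
next
  case (eng h1 h2)
  then obtain k s t l s' t' where "(s, t) \<in> inoue_lattice a b" "(s', t') \<in> inoue_lattice a b" "h1 = inoue_aff_map k s t" "h2 = inoue_aff_map l s' t'"
    by blast
  note * = this
  have "(\<beta> powi k * s' + s, \<alpha> powi k * t' + t) \<in> inoue_lattice a b"
    using inoue_lattice_add[OF inoue_lattice_powi[OF *(2)] *(1)] by simp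
  then show ?case unfolding *(3,4) inoue_aff_map_mult by blast
qed

lemma proj_eq: "inoue_proj \<alpha> \<beta> a b x =
    {h x | h. h \<in> generate (BijGroup CH) (inoue_generators \<alpha> \<beta> a b)}"
  by (simp add: inoue_proj_def orbit_def inoue_group_def)

lemma gens_carrier: "inoue_generators \<alpha> \<beta> a b \<subseteq> carrier (BijGroup CH)"
proof
  fix h assume "h \<in> inoue_generators \<alpha> \<beta> a b"
  then obtain k s t where "h = inoue_aff_map k s t" using gen_form_incl by blast
  then show "h \<in> carrier (BijGroup CH)" using inoue_aff_map_Bij by (simp add: BijGroup_def)
qed

lemma proj_mem: "x \<in> CH \<Longrightarrow> x \<in> inoue_proj \<alpha> \<beta> a b x"
proof -
  assume "x \<in> CH"
  then have "x = \<one>\<^bsub>BijGroup CH\<^esub> x" by (simp add: BijGroup_def)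
  then show ?thesis unfolding proj_eq by (auto intro: generate.one)
qed

lemma BijGroup_mult_apply:
  "g \<in> carrier (BijGroup CH) \<Longrightarrow> h \<in> carrier (BijGroup CH) \<Longrightarrow> x \<in> CH \<Longrightarrow>
   (g \<otimes>\<^bsub>BijGroup CH\<^esub> h) x = g (h x)"
  by (simp add: BijGroup_def compose_def)

lemma proj_group:
  assumes g: "g \<in> generate (BijGroup CH) (inoue_generators \<alpha> \<beta> a b)" and x: "x \<in> CH"
  shows "inoue_proj \<alpha> \<beta> a b (g x) = inoue_proj \<alpha> \<beta> a b x"
proof -
  let ?B = "BijGroup CH" let ?G = "generate ?B (inoue_generators \<alpha> \<beta> a b)"
  interpret B: group ?B by (rule group_BijGroup)
  have sub: "subgroup ?G ?B" by (rule B.generate_is_subgroup[OF gens_carrier])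
  note c = subgroup.mem_carrier[OF sub]
  have gx: "g x \<in> CH" using c[OF g] x by (auto simp: BijGroup_def Bij_def bij_betw_def)
  have i: "inv\<^bsub>?B\<^esub> g \<in> ?G" using sub g by (rule subgroup.m_inv_closed)
  have "h (g x) \<in> inoue_proj \<alpha> \<beta> a b x" if h: "h \<in> ?G" for h
    unfolding proj_eq BijGroup_mult_apply[OF c[OF h] c[OF g] x, symmetric]
    using generate.eng[OF h g] by blast
  moreover have "h x \<in> inoue_proj \<alpha> \<beta> a b (g x)" if h: "h \<in> ?G" for h
  proof -
    have k: "h \<otimes>\<^bsub>?B\<^esub> inv\<^bsub>?B\<^esub> g \<in> ?G" using generate.eng[OF h i] .
    have "(h \<otimes>\<^bsub>?B\<^esub> inv\<^bsub>?B\<^esub> g) (g x) = ((h \<otimes>\<^bsub>?B\<^esub> inv\<^bsub>?B\<^esub> g) \<otimes>\<^bsub>?B\<^esub> g) x"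
      by (rule BijGroup_mult_apply[symmetric, OF c[OF k] c[OF g] x])
    also have "\<dots> = h x" using c[OF h] c[OF g] by (simp add: B.m_assoc)
    finally show ?thesis unfolding proj_eq using k by (metis (mono_tags, lifting) mem_Collect_eq)
  qed
  ultimately show ?thesis using proj_eq[of x] proj_eq[of "g x"] by (intro subset_antisym subsetI) auto
qed

lemma proj_eqD:
  assumes "inoue_proj \<alpha> \<beta> a b x = inoue_proj \<alpha> \<beta> a b y" "x \<in> CH" "y \<in> CH"
  obtains k s t where "(s, t) \<in> inoue_lattice a b" "y = inoue_aff \<alpha> \<beta> k s t x"
    "inoue_aff_map k s t \<in> generate (BijGroup CH) (inoue_generators \<alpha> \<beta> a b)"
proof -
  have "y \<in> inoue_proj \<alpha> \<beta> a b x" using proj_mem[OF assms(3)] assms(1) by simp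
  then obtain h where h: "h \<in> generate (BijGroup CH) (inoue_generators \<alpha> \<beta> a b)" "y = h x"
    unfolding proj_eq by blast
  then obtain k s t where "(s, t) \<in> inoue_lattice a b" "h = inoue_aff_map k s t" using gen_form by blast
  then show ?thesis using h assms(2) that by auto
qed

lemma open_CH: "open CH"
  unfolding CH_def by (intro open_Times open_UNIV open_halfspace_Im_gt)

lemma inoue_evenly_covered: 
  assumes p: "p \<in> CH"
  obtains U where "open U" "p \<in> U" "U \<subseteq> CH" "inj_on (inoue_proj \<alpha> \<beta> a b) U"
proof -
  obtain c where c: "c > 0" "\<And>s t. (s, t) \<in> inoue_lattice a b \<Longrightarrow> norm (s, t) < c \<Longrightarrow> s = 0 \<and> t = 0"
    proof -
    from inoue_lattice_discrete obtain c where c: "c > 0" "\<forall>(s,t)\<in>inoue_lattice a b. norm (s,t) < c \<longrightarrow> s = 0 \<and> t = 0"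
      by (elim exE conjE)
    show ?thesis by (rule that[OF c(1)]) (use bspec[OF c(2)] in force)
  qed
  define y where "y = Im (snd p)"
  have y: "y > 0" using p by (auto simp: CH_def y_def)
  have sa: "sqrt \<alpha> > 1" using alpha_gt_1 by simp
  define U where "U = ball p (c/2) \<inter> (CH \<inter> {q. Im (snd q) < sqrt \<alpha> * y} \<inter> {q. y / sqrt \<alpha> < Im (snd q)})"
  have "open U" unfolding U_def
    by (intro open_Int open_CH open_ball open_Collect_less continuous_intros)
  moreover have "p \<in> U" using p c(1) sa y by (auto simp: U_def y_def[symmetric] divide_less_eq)
  moreover have "U \<subseteq> CH" by (auto simp: U_def)
  moreover have "inj_on (inoue_proj \<alpha> \<beta> a b) U"
  proof (rule inj_onI)
    fix q r assume q: "q \<in> U" and r: "r \<in> U" and e: "inoue_proj \<alpha> \<beta> a b q = inoue_proj \<alpha> \<beta> a b r"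
    have qr: "q \<in> CH" "r \<in> CH" using q r by (auto simp: U_def)
    obtain k s t where st: "(s, t) \<in> inoue_lattice a b" and rq: "r = inoue_aff \<alpha> \<beta> k s t q"
      by (rule proj_eqD[OF e qr])
    have Im: "Im (snd r) = \<alpha> powi k * Im (snd q)"
      unfolding rq inoue_aff_def split_beta snd_conv by (simp del: of_real_power_int)
    have ss: "sqrt \<alpha> * sqrt \<alpha> = \<alpha>" using alpha_gt_1 by simp
    have b1: "Im (snd r) < \<alpha> * Im (snd q)" "Im (snd q) < \<alpha> * Im (snd r)"
    proof -
      have *: "u < \<alpha> * v" if "u < sqrt \<alpha> * y" "y / sqrt \<alpha> < v" for u v
      proof -
        have "y < v * sqrt \<alpha>" using that(2) sa by (simp add: divide_less_eq)
        then have "sqrt \<alpha> * y < sqrt \<alpha> * (v * sqrt \<alpha>)" using sa by simp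
        also have "\<dots> = \<alpha> * v" using arg_cong[OF ss, of "\<lambda>u. u * v"] by (simp only: mult_ac)
        finally show ?thesis using that by simp
      qed
      show "Im (snd r) < \<alpha> * Im (snd q)" "Im (snd q) < \<alpha> * Im (snd r)"
        using q r by (auto intro!: * simp: U_def)
    qed
    have pos: "Im (snd q) > 0" using q by (auto simp: U_def CH_def)
    have k0: "k = 0"
    proof (rule ccontr)
      assume "k \<noteq> 0"
      then consider "k \<ge> 1" | "k \<le> -1" by linarith
      then show False
      proof cases
        case 1
        have "\<alpha> powi 1 \<le> \<alpha> powi k" using 1 alpha_gt_1 by (intro power_int_increasing) auto
        then have "\<alpha> * Im (snd q) \<le> \<alpha> powi k * Im (snd q)" using pos by simp
        then show False using b1(1) unfolding Im by linarith
      next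
        case 2
        have "\<alpha> powi k \<le> \<alpha> powi (-1)" using 2 alpha_gt_1 by (intro power_int_increasing) auto
        then have "\<alpha> * \<alpha> powi k \<le> 1" using alpha_gt_1 mult_left_mono[of "\<alpha> powi k" "\<alpha> powi (-1)" \<alpha>] by (simp add: power_int_minus)
        from mult_right_mono[OF this, of "Im (snd q)"]
        have "\<alpha> * (\<alpha> powi k * Im (snd q)) \<le> Im (snd q)" using pos by (simp add: mult.assoc)
        then show False using b1(2) unfolding Im by linarith
      qed
    qed
    have rq': "r = q + (s, of_real t)" by (simp add: rq k0 inoue_aff_def split_beta prod_eq_iff)
    have "norm (s, t) = norm (r - q)" by (simp add: rq' norm_Pair)
    also have "\<dots> = dist r q" by (simp add: dist_norm)
    also have "\<dots> \<le> dist r p + dist q p" by (rule dist_triangle2)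
    also have "\<dots> < c" using q r by (simp add: U_def dist_commute)
    finally have "s = 0 \<and> t = 0" using c(2)[OF st] by simp
    then show "q = r" by (simp add: rq' prod_eq_iff)
  qed
  ultimately show ?thesis using that by blast
qed

lemma inoue_aff_has_derivative:
  "(inoue_aff \<alpha> \<beta> k s t has_derivative (\<lambda>v. (\<beta> powi k * fst v, of_real (\<alpha> powi k) * snd v))) (at x)"
proof -
  have "((\<lambda>v. c * f v + d) has_derivative (\<lambda>v. c * f v)) (at x)"
    if "bounded_linear f" for c d :: complex and f :: "complex \<times> complex \<Rightarrow> complex"
    using has_derivative_add_const[OF has_derivative_mult_right[OF bounded_linear_imp_has_derivative[OF that]]] .
  from has_derivative_Pair[OF this[OF bounded_linear_fst] this[OF bounded_linear_snd]]
  show ?thesis unfolding inoue_aff_def split_beta .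
qed

theorem inoue_complex_atlas:
  "complex_atlas (inoue_surface \<alpha> \<beta> a b) (inoue_atlas \<alpha> \<beta> a b)"
proof -
  let ?p = "inoue_proj \<alpha> \<beta> a b"
  have S: "inoue_surface \<alpha> \<beta> a b = ?p ` CH"
    by (auto simp: inoue_surface_def orbits_def inoue_proj_def)
  have cov: "(\<Union>c\<in>inoue_atlas \<alpha> \<beta> a b. fst c) = ?p ` CH"
  proof safe
    fix y c assume "c \<in> inoue_atlas \<alpha> \<beta> a b" "y \<in> fst c"
    then show "y \<in> ?p ` CH" unfolding inoue_atlas_def by fastforce
  next
    fix x assume "x \<in> CH"
    then obtain U where "open U" "x \<in> U" "U \<subseteq> CH" "inj_on ?p U" by (rule inoue_evenly_covered)
    then show "?p x \<in> (\<Union>c\<in>inoue_atlas \<alpha> \<beta> a b. fst c)"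
      unfolding inoue_atlas_def by (intro UN_I[of "(?p ` U, inv_into U ?p)"]) auto
  qed
  have inj: "inj_on (snd c) (fst c) \<and> open (chart_range c)" if "c \<in> inoue_atlas \<alpha> \<beta> a b" for c
    using that by (auto simp: inoue_atlas_def chart_range_def inj_on_inv_into)
  have tr: "open (overlap c d) \<and>
        (\<forall>x\<in>overlap c d. transition c d differentiable (at x) \<and>
           (\<forall>v. transition_deriv c d x (J v) = J (transition_deriv c d x v)))"
    if c: "c \<in> inoue_atlas \<alpha> \<beta> a b" and d: "d \<in> inoue_atlas \<alpha> \<beta> a b" for c d
  proof -
    obtain U where U: "open U" "U \<subseteq> CH" "inj_on ?p U" and cU: "c = (?p ` U, inv_into U ?p)"
      using c unfolding inoue_atlas_def by blast
    obtain V where V: "open V" "V \<subseteq> CH" "inj_on ?p V" and dV: "d = (?p ` V, inv_into V ?p)"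
      using d unfolding inoue_atlas_def by blast
    have ov: "overlap c d = {x\<in>U. ?p x \<in> ?p ` V}"
    proof (intro subset_antisym subsetI)
      fix x assume "x \<in> overlap c d"
      then obtain q where q: "q \<in> ?p ` U" "q \<in> ?p ` V" "x = inv_into U ?p q"
        by (auto simp: overlap_def cU dV)
      then show "x \<in> {x\<in>U. ?p x \<in> ?p ` V}"
        using inv_into_into[OF q(1)] f_inv_into_f[OF q(1)] by simp
    next
      fix x assume x: "x \<in> {x\<in>U. ?p x \<in> ?p ` V}"
      then have "x = inv_into U ?p (?p x)" using U(3) by simp
      then show "x \<in> overlap c d"
        unfolding overlap_def cU dV fst_conv snd_conv using x by blast
    qed
    have ci: "chart_inv c x = ?p x" if "x \<in> U" for x
    proof -
      have "inj_on (inv_into U ?p) (?p ` U)" by (rule inj_on_inv_into) simp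
      then show ?thesis using that U(3)
        by (simp add: chart_inv_def cU inv_into_f_eq)
    qed
    have loc: "\<exists>W k s t. open W \<and> x \<in> W \<and> W \<subseteq> overlap c d \<and> (\<forall>y\<in>W. transition c d y = inoue_aff \<alpha> \<beta> k s t y)"
      if x: "x \<in> overlap c d" for x
    proof -
      obtain y where y: "y \<in> V" "?p x = ?p y" and xU: "x \<in> U" using x unfolding ov by blast
      obtain k s t where k: "y = inoue_aff \<alpha> \<beta> k s t x"
        "inoue_aff_map k s t \<in> generate (BijGroup CH) (inoue_generators \<alpha> \<beta> a b)"
        using proj_eqD[OF y(2)] xU y(1) U V by blast
      define W where "W = U \<inter> inoue_aff \<alpha> \<beta> k s t -` V"
      have "open W" unfolding W_def
        by (intro open_Int U open_vimage V)
          (auto simp: inoue_aff_def split_beta intro!: continuous_intros)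
      moreover have "x \<in> W" using xU y k by (simp add: W_def)
      moreover have pW: "?p (inoue_aff \<alpha> \<beta> k s t z) = ?p z" if "z \<in> W" for z
      proof -
        have "z \<in> CH" using that U by (auto simp: W_def)
        then show ?thesis using proj_group[OF k(2), of z] by simp
      qed
      moreover have "W \<subseteq> overlap c d"
      proof
        fix z assume z: "z \<in> W"
        then have "?p z \<in> ?p ` V" using pW[OF z, symmetric] by (auto simp: W_def)
        then show "z \<in> overlap c d" using z unfolding ov W_def by blast
      qed
      moreover have "transition c d z = inoue_aff \<alpha> \<beta> k s t z" if z: "z \<in> W" for z
      proof -
        have "transition c d z = inv_into V ?p (?p z)"
          using z by (simp add: transition_def ci W_def dV)
        also have "\<dots> = inv_into V ?p (?p (inoue_aff \<alpha> \<beta> k s t z))" by (simp add: pW z)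
        also have "\<dots> = inoue_aff \<alpha> \<beta> k s t z" using z V by (simp add: W_def inv_into_f_f)
        finally show ?thesis .
      qed
      ultimately show ?thesis by blast
    qed
    have "open (overlap c d)" by (subst open_subopen) (use loc in blast)
    moreover have "transition c d differentiable (at x) \<and>
           (\<forall>v. transition_deriv c d x (J v) = J (transition_deriv c d x v))"
      if x: "x \<in> overlap c d" for x
    proof -
      obtain W k s t where W: "open W" "x \<in> W" "\<And>y. y \<in> W \<Longrightarrow> transition c d y = inoue_aff \<alpha> \<beta> k s t y"
        using loc[OF x] by blast
      have h: "(transition c d has_derivative (\<lambda>v. (\<beta> powi k * fst v, of_real (\<alpha> powi k) * snd v))) (at x)"
        by (rule has_derivative_transform_within_open[OF inoue_aff_has_derivative W(1,2)]) (simp add: W(3))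
      show ?thesis
        unfolding frechet_derivative_at[OF h, symmetric] J_def fst_conv snd_conv
        using differentiableI[OF h] by (simp only: mult.left_commute simp_thms)
    qed
    ultimately show ?thesis by blast
  qed
  have "\<forall>c\<in>inoue_atlas \<alpha> \<beta> a b. inj_on (snd c) (fst c) \<and> open (chart_range c)"
    by (intro ballI inj)
  moreover note ballI[OF ballI[OF tr]]
  ultimately show ?thesis unfolding complex_atlas_def S by (intro conjI cov)
qed

end

end

theory Submission
  imports Defs
begin

text \<open>
  The universal cover of the surface is \<open>CH\<close>, with coordinates \<open>(z, w)\<close>, \<open>z = x + iy\<close> and
  \<open>w = w\<^sub>1 + iw\<^sub>2\<close>. Because \<open>CH\<close> is convex, the Lee form of an LCK metric pulls back to an exact form
  \<open>dF\<close> (\<open>poincare_convex\<close>), and \<open>F\<close> changes under every deck transformation \<open>\<gamma>\<close> by a constant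
  \<open>\<chi>(\<gamma>)\<close>. The character \<open>\<chi>\<close> vanishes on the lattice of translations: conjugation with the
  generator \<open>\<gamma>\<^sub>0(z, w) = (\<beta>z, \<alpha>w)\<close> acts on the lattice through a matrix with the characteristic
  polynomial of \<open>A\<close>, of which 1 is not a root. So \<open>\<chi>\<close> is given by the single number
  \<open>c = \<chi>(\<gamma>\<^sub>0)\<close> (\<open>deck_character\<close>). For the form \<open>dw\<^sub>2/w\<^sub>2 = d(ln w\<^sub>2)\<close> this number is
  \<open>ln \<alpha>\<close>. Once \<open>c = ln \<alpha>\<close> is known, \<open>F - ln w\<^sub>2\<close> is invariant, so it is a smooth function on the
  surface whose differential is the difference of the two Lee forms.

  To find \<open>c\<close>, let \<open>\<omega>\<close> be the pullback of the fundamental form. The form \<open>\<Omega> = e\<^sup>-\<^sup>F \<omega>\<close> is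
  closed, because \<open>d\<omega> = dF \<and> \<omega>\<close>. It is invariant under the lattice, which acts cocompactly on each
  slab \<open>s\<^sub>0 \<le> w\<^sub>2 \<le> s\<^sub>1\<close>; hence its coefficients are bounded on slabs, and the coefficient of
  \<open>dx \<and> dy\<close>, which is positive, lies between positive constants \<open>m\<close> and \<open>M\<close> on the
  hypersurface \<open>w\<^sub>2 = 1\<close>. The map \<open>\<gamma>\<^sub>0\<^sup>n\<close> carries that hypersurface to \<open>w\<^sub>2 = \<alpha>\<^sup>n\<close> and multiplies
  this coefficient by \<open>r\<^sup>n\<close> with \<open>r = \<alpha> e\<^sup>-\<^sup>c\<close>; here \<open>\<alpha> \<bar>\<beta>\<bar>\<^sup>2 = det A = 1\<close> is used. Stokes'
  theorem on the box with \<open>0 \<le> x, y \<le> N\<close>, \<open>w\<^sub>1 = 0\<close> and \<open>1 \<le> w\<^sub>2 \<le> \<alpha>\<^sup>n\<close> says that the fluxes of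
  \<open>\<Omega>\<close> through the bottom and the top differ by the flux through the sides. The former grow like
  \<open>N\<^sup>2\<close> and the latter is at most of order \<open>N\<close>. Letting \<open>N\<close> tend to infinity
  (\<open>flux_comparison\<close>) gives \<open>m r\<^sup>n \<le> M\<close> and \<open>m \<le> M r\<^sup>n\<close> for every \<open>n\<close>, which is possible only
  for \<open>r = 1\<close>, that is \<open>c = ln \<alpha>\<close> (\<open>lee_form_multiplier\<close>).
\<close>


section \<open>Smooth functions\<close>

lemma frechet_derivative_local:
  fixes f g :: "'e::euclidean_space \<Rightarrow> real"
  assumes "f differentiable (at x)" "open U" "x \<in> U" "\<And>y. y \<in> U \<Longrightarrow> f y = g y"
  shows "g differentiable (at x)" "frechet_derivative g (at x) = frechet_derivative f (at x)"
proof -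
  have "(f has_derivative frechet_derivative f (at x)) (at x)"
    using assms(1) by (simp add: frechet_derivative_works)
  then have *: "(g has_derivative frechet_derivative f (at x)) (at x)"
    by (rule has_derivative_transform_within_open[OF _ assms(2,3,4)])
  show "g differentiable (at x)" using * by (rule differentiableI)
  show "frechet_derivative g (at x) = frechet_derivative f (at x)"
    using frechet_derivative_at[OF *] by simp
qed

text \<open>
  Smoothness may be checked on the chart domains, where a lifted tensor field agrees with its
  coordinate expression.
\<close>

lemma Ck_on_local:
  assumes "\<And>x. x \<in> S \<Longrightarrow> \<exists>U h. open U \<and> x \<in> U \<and> Ck_on k h U \<and> (\<forall>y\<in>U. h y = f y)"
  shows "Ck_on k f S"
  using assms
proof (induction k arbitrary: f)
  case 0
  have "isCont f x" if x: "x \<in> S" for x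
  proof -
    obtain U h where U: "open U" "x \<in> U" "continuous_on U h" "\<And>y. y \<in> U \<Longrightarrow> h y = f y"
      using 0[OF x] by auto
    then have "continuous_on U f" by (metis continuous_on_cong)
    then show ?thesis using U(1,2) by (simp add: continuous_on_eq_continuous_at)
  qed
  then show ?case by (simp add: continuous_at_imp_continuous_on)
next
  case (Suc k)
  have d: "f differentiable (at x)"
    and ck: "\<exists>U h. open U \<and> x \<in> U \<and> Ck_on k h U \<and> (\<forall>y\<in>U. h y = frechet_derivative f (at y) v)"
    if x: "x \<in> S" for x v
  proof -
    obtain U h where U: "open U" "x \<in> U" "Ck_on (Suc k) h U" "\<And>y. y \<in> U \<Longrightarrow> h y = f y"
      using Suc.prems[OF x] by auto
    have l: "f differentiable (at y)" "frechet_derivative f (at y) = frechet_derivative h (at y)"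
      if "y \<in> U" for y
      using frechet_derivative_local[of h y U f] U that by auto
    show "f differentiable (at x)" using l(1) U(2) .
    show "\<exists>U h. open U \<and> x \<in> U \<and> Ck_on k h U \<and> (\<forall>y\<in>U. h y = frechet_derivative f (at y) v)"
      using U l(2) by (intro exI[of _ U] exI[of _ "\<lambda>y. frechet_derivative h (at y) v"]) auto
  qed
  show ?case using Suc.IH[OF ck] d by simp
qed

lemma Ck_on_cong:
  assumes "open S" "Ck_on k f S" "\<And>x. x \<in> S \<Longrightarrow> f x = g x"
  shows "Ck_on k g S"
  using assms by (intro Ck_on_local) auto

lemma Ck_on_subset: "Ck_on k f S \<Longrightarrow> T \<subseteq> S \<Longrightarrow> Ck_on k f T"
  by (induction k arbitrary: f) (auto intro: continuous_on_subset)

lemma Ck_on_add: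
  assumes "open S" "Ck_on k f S" "Ck_on k g S"
  shows "Ck_on k (\<lambda>x. f x + c * g x) S"
  using assms(2,3)
proof (induction k arbitrary: f g)
  case 0 then show ?case by (auto intro!: continuous_intros)
next
  case (Suc k)
  have d: "((\<lambda>x. f x + c * g x) has_derivative
      (\<lambda>v. frechet_derivative f (at x) v + c * frechet_derivative g (at x) v)) (at x)"
    if "x \<in> S" for x
    using Suc.prems that by (auto intro!: derivative_eq_intros simp: frechet_derivative_works)
  have "Ck_on k (\<lambda>x. frechet_derivative (\<lambda>x. f x + c * g x) (at x) v) S" for v
  proof (rule Ck_on_cong[OF assms(1)])
    show "Ck_on k (\<lambda>x. frechet_derivative f (at x) v + c * frechet_derivative g (at x) v) S"
      using Suc.prems by (intro Suc.IH) auto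
  qed (simp add: frechet_derivative_at[OF d, symmetric])
  moreover have "\<forall>x\<in>S. (\<lambda>x. f x + c * g x) differentiable (at x)"
    using d by (auto intro: differentiableI)
  ultimately show ?case unfolding Ck_on.simps by blast
qed

lemma smooth_on_add_scaled:
  "open S \<Longrightarrow> smooth_on f S \<Longrightarrow> smooth_on g S \<Longrightarrow> smooth_on (\<lambda>x. f x + c * g x) S"
  by (simp add: smooth_on_def Ck_on_add)

lemma smooth_on_cong:
  "open S \<Longrightarrow> smooth_on f S \<Longrightarrow> (\<And>x. x \<in> S \<Longrightarrow> f x = g x) \<Longrightarrow> smooth_on g S"
  unfolding smooth_on_def using Ck_on_cong by blast

lemma smooth_on_has_derivative:
  "smooth_on f S \<Longrightarrow> x \<in> S \<Longrightarrow> (f has_derivative frechet_derivative f (at x)) (at x)"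
  unfolding smooth_on_def frechet_derivative_works[symmetric] using Ck_on.simps(2) by blast

lemma smooth_on_continuous: "smooth_on f S \<Longrightarrow> continuous_on S f"
  unfolding smooth_on_def using Ck_on.simps(1) by blast

lemma smooth_on_continuous_derivative:
  "smooth_on f S \<Longrightarrow> continuous_on S (\<lambda>x. frechet_derivative f (at x) v)"
  unfolding smooth_on_def using Ck_on.simps by blast

lemma smooth_onI_derivative:
  assumes "open S" and "\<And>x. x \<in> S \<Longrightarrow> (f has_derivative f' x) (at x)"
    and "\<And>v. smooth_on (\<lambda>x. f' x v) S"
  shows "smooth_on f S"
  unfolding smooth_on_def
proof
  fix k
  have d: "Ck_on (Suc k) f S" for k
    unfolding Ck_on.simps
  proof (intro conjI ballI allI)
    show "f differentiable at x" if "x \<in> S" for x using assms(2)[OF that] by (rule differentiableI)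
    show "Ck_on k (\<lambda>x. frechet_derivative f (at x) v) S" for v
      by (rule Ck_on_cong[OF assms(1), of k "\<lambda>x. f' x v"])
        (use assms(3) in \<open>simp_all add: smooth_on_def frechet_derivative_at[OF assms(2), symmetric]\<close>)
  qed
  have "continuous_on S f"
    using assms(2) by (meson continuous_at_imp_continuous_on has_derivative_continuous)
  then show "Ck_on k f S" using d by (cases k) auto
qed

section \<open>The Poincare lemma for 1-forms\<close>

text \<open>
  With a base point \<open>p\<close> the primitive is \<open>F(x) = \<integral>\<^sub>0\<^sup>1 \<eta>\<^bsub>p+t(x-p)\<^esub>(x - p) dt\<close>. Differentiating
  under the integral sign in the direction \<open>v\<close> and using closedness turns the integrand into the
  \<open>t\<close>-derivative of \<open>t \<eta>\<^bsub>p+t(x-p)\<^esub>(v)\<close>.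
\<close>

lemma poincare_convex:
  fixes \<eta> :: "'e::euclidean_space \<Rightarrow> 'e \<Rightarrow> real"
  assumes S: "open S" "convex S"
    and lin: "\<And>x. x \<in> S \<Longrightarrow> linear (\<eta> x)"
    and sm: "\<And>v. smooth_on (\<lambda>x. \<eta> x v) S"
    and closed: "\<And>x u v. x \<in> S \<Longrightarrow> ext_d1 \<eta> x u v = 0"
  obtains F where "\<And>x. x \<in> S \<Longrightarrow> (F has_derivative \<eta> x) (at x)"
proof (cases "S = {}")
  case True then show ?thesis using that by blast
next
  case False
  then obtain p where p: "p \<in> S" by blast
  define c where "c x t = p + t *\<^sub>R (x - p)" for x and t :: real
  define D where "D y w u = frechet_derivative (\<lambda>y. \<eta> y w) (at y) u" for y w u
  have cS: "c x t \<in> S" if "x \<in> S" "t \<in> cbox 0 1" for x t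
  proof -
    have "(1 - t) *\<^sub>R p + t *\<^sub>R x \<in> S" using that p S(2) by (auto intro: convexD_alt)
    then show ?thesis by (simp add: c_def algebra_simps)
  qed
  have D: "((\<lambda>y. \<eta> y w) has_derivative D y w) (at y)" if "y \<in> S" for y w
    unfolding D_def by (rule smooth_on_has_derivative[OF sm that])
  have linD: "linear (D y w)" if "y \<in> S" for y w
    using D[OF that] by (rule has_derivative_linear)
  have symD: "D y w u = D y u w" if "y \<in> S" for y u w
    using closed[OF that, of u w] by (simp add: ext_d1_def D_def)
  \<comment> \<open>The derivative of the integrand, in a form that is visibly obtained by the product rule; \<open>Lval\<close>
    below is its simplification by closedness.\<close>
  define L where "L x t v = (\<Sum>i\<in>Basis. ((x - p) \<bullet> i) * D (c x t) i (t *\<^sub>R v) + (v \<bullet> i) * \<eta> (c x t) i)"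
    for x t v
  have L: "((\<lambda>x. \<eta> (c x t) (x - p)) has_derivative L x t) (at x)" if x: "x \<in> S" "t \<in> cbox 0 1" for x t
  proof -
    have c': "((\<lambda>x. c x t) has_derivative (\<lambda>v. t *\<^sub>R v)) (at x)"
      unfolding c_def by (auto intro!: derivative_eq_intros)
    have 1: "((\<lambda>x. \<eta> (c x t) i) has_derivative (\<lambda>v. D (c x t) i (t *\<^sub>R v))) (at x)" for i
      using has_derivative_compose[OF c' D[OF cS[OF x]]] .
    have "((\<lambda>x. \<Sum>i\<in>Basis. ((x - p) \<bullet> i) * \<eta> (c x t) i) has_derivative L x t) (at x)"
      unfolding L_def by (intro has_derivative_sum) (auto intro!: derivative_eq_intros 1)
    moreover have "(\<Sum>i\<in>Basis. ((y - p) \<bullet> i) * \<eta> (c y t) i) = \<eta> (c y t) (y - p)" if "y \<in> S" for y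
    proof -
      have "\<eta> (c y t) (y - p) = \<eta> (c y t) (\<Sum>i\<in>Basis. ((y - p) \<bullet> i) *\<^sub>R i)"
        by (simp add: euclidean_representation)
      then show ?thesis
        by (simp add: linear_sum[OF lin[OF cS[OF that x(2)]]] linear_cmul[OF lin[OF cS[OF that x(2)]]])
    qed
    ultimately show ?thesis
      by (rule has_derivative_transform_within_open[OF _ S(1) x(1)])
  qed
  have bl: "bounded_linear (L x t)" if "x \<in> S" "t \<in> cbox 0 1" for x t
    using L[OF that] by (rule has_derivative_bounded_linear)
  have Lval: "L x t v = t * D (c x t) v (x - p) + \<eta> (c x t) v" if x: "x \<in> S" "t \<in> cbox 0 1" for x t v
  proof -
    note cx = cS[OF x]
    have "D (c x t) v (x - p) = D (c x t) v (\<Sum>i\<in>Basis. ((x - p) \<bullet> i) *\<^sub>R i)"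
      by (simp add: euclidean_representation)
    also have "\<dots> = (\<Sum>i\<in>Basis. ((x - p) \<bullet> i) * D (c x t) i v)"
      by (simp add: linear_sum[OF linD[OF cx]] linear_cmul[OF linD[OF cx]] symD[OF cx, of v])
    finally have 1: "t * D (c x t) v (x - p) = (\<Sum>i\<in>Basis. ((x - p) \<bullet> i) * D (c x t) i (t *\<^sub>R v))"
      by (simp add: linear_cmul[OF linD[OF cx]] sum_distrib_left mult_ac)
    have "\<eta> (c x t) v = \<eta> (c x t) (\<Sum>i\<in>Basis. (v \<bullet> i) *\<^sub>R i)"
      by (simp add: euclidean_representation)
    also have "\<dots> = (\<Sum>i\<in>Basis. (v \<bullet> i) * \<eta> (c x t) i)"
      by (simp add: linear_sum[OF lin[OF cx]] linear_cmul[OF lin[OF cx]])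
    finally show ?thesis by (simp add: L_def 1 sum.distrib)
  qed
  have cc: "continuous_on (S \<times> cbox 0 1) (\<lambda>z. c (fst z) (snd z))"
    unfolding c_def by (intro continuous_intros)
  have cim: "(\<lambda>z. c (fst z) (snd z)) ` (S \<times> cbox 0 1) \<subseteq> S" using cS by auto
  have cont: "continuous_on (S \<times> cbox 0 1) (\<lambda>(x, t). Blinfun (L x t))"
  proof (rule continuous_on_blinfun_componentwise)
    fix i :: 'e
    have "continuous_on (S \<times> cbox 0 1) (\<lambda>z. snd z * D (c (fst z) (snd z)) i (fst z - p) + \<eta> (c (fst z) (snd z)) i)"
    proof (intro continuous_intros)
      show "continuous_on (S \<times> cbox 0 1) (\<lambda>z. \<eta> (c (fst z) (snd z)) i)"
        using continuous_on_compose2[OF smooth_on_continuous[OF sm] cc cim] .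
      have "continuous_on (S \<times> cbox 0 1) (\<lambda>z. \<Sum>j\<in>Basis. ((fst z - p) \<bullet> j) * D (c (fst z) (snd z)) i j)"
        unfolding D_def
        by (intro continuous_intros continuous_on_compose2[OF smooth_on_continuous_derivative[OF sm] cc cim])
      moreover have "D (c x t) i (x - p) = (\<Sum>j\<in>Basis. ((x - p) \<bullet> j) * D (c x t) i j)"
        if "x \<in> S" "t \<in> cbox 0 1" for x t
      proof -
        have "D (c x t) i (x - p) = D (c x t) i (\<Sum>j\<in>Basis. ((x - p) \<bullet> j) *\<^sub>R j)"
          by (simp add: euclidean_representation)
        then show ?thesis
          by (simp add: linear_sum[OF linD[OF cS[OF that]]] linear_cmul[OF linD[OF cS[OF that]]])
      qed
      ultimately show "continuous_on (S \<times> cbox 0 1) (\<lambda>z. D (c (fst z) (snd z)) i (fst z - p))"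
        by (subst continuous_on_cong[OF refl]) auto
    qed
    then show "continuous_on (S \<times> cbox 0 1) (\<lambda>z. blinfun_apply (case z of (x, t) \<Rightarrow> Blinfun (L x t)) i)"
      by (rule continuous_on_eq) (auto simp: bounded_linear_Blinfun_apply[OF bl] Lval)
  qed
  define F where "F x = integral (cbox 0 1) (\<lambda>t. \<eta> (c x t) (x - p))" for x
  have "(F has_derivative \<eta> x) (at x)" if x: "x \<in> S" for x
  proof -
    have ci: "continuous_on (cbox 0 1) (\<lambda>t. \<eta> (c y t) (y - p))" if "y \<in> S" for y
      by (rule continuous_on_compose2[OF smooth_on_continuous[OF sm], of _ "c y"])
        (use cS[OF that] in \<open>auto simp: c_def intro!: continuous_intros\<close>)
    have "(F has_derivative blinfun_apply (integral (cbox 0 1) (\<lambda>t. Blinfun (L x t)))) (at x within S)"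
      unfolding F_def
    proof (rule leibniz_rule[OF _ _ cont x S(2)])
      show "((\<lambda>x. \<eta> (c x t) (x - p)) has_derivative blinfun_apply (Blinfun (L x t))) (at x within S)"
        if "x \<in> S" "t \<in> cbox 0 1" for x t
        using L[OF that] by (simp add: bounded_linear_Blinfun_apply[OF bl[OF that]] has_derivative_at_withinI)
      show "(\<lambda>t. \<eta> (c y t) (y - p)) integrable_on cbox 0 1" if "y \<in> S" for y
        using ci[OF that] by (rule integrable_continuous)
    qed
    moreover have "blinfun_apply (integral (cbox 0 1) (\<lambda>t. Blinfun (L x t))) v = \<eta> x v" for v
    proof -
      have "continuous_on (cbox 0 1) (\<lambda>t. Blinfun (L x t))"
        using continuous_on_compose2[OF cont continuous_on_Pair[OF continuous_on_const continuous_on_id]] x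
        by auto
      then have "((\<lambda>t. Blinfun (L x t)) has_integral integral (cbox 0 1) (\<lambda>t. Blinfun (L x t))) (cbox 0 1)"
        by (intro integrable_integral integrable_continuous)
      from has_integral_linear[OF this blinfun.bounded_linear_left[of v]]
      have i1: "((\<lambda>t. L x t v) has_integral blinfun_apply (integral (cbox 0 1) (\<lambda>t. Blinfun (L x t))) v) (cbox 0 1)"
        by (rule has_integral_eq[rotated]) (simp add: bounded_linear_Blinfun_apply[OF bl[OF x]])
      have d: "((\<lambda>t. t * \<eta> (c x t) v) has_vector_derivative L x t v) (at t within {0..1})"
        if t: "t \<in> {0..1}" for t
      proof -
        have t': "t \<in> cbox 0 1" using t by simp
        have c': "((\<lambda>t. c x t) has_derivative (\<lambda>h. h *\<^sub>R (x - p))) (at t)"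
          unfolding c_def by (auto intro!: derivative_eq_intros)
        note 1 = has_derivative_compose[OF c' D[OF cS[OF x t']], of v]
        have "((\<lambda>t. t * \<eta> (c x t) v) has_derivative (\<lambda>h. h *\<^sub>R L x t v)) (at t)"
          by (rule has_derivative_eq_rhs[OF has_derivative_mult[OF has_derivative_ident 1]])
            (simp add: fun_eq_iff Lval[OF x t'] linear_cmul[OF linD[OF cS[OF x t']]] ring_distribs)
        then show ?thesis
          by (simp only: has_vector_derivative_def has_derivative_at_withinI)
      qed
      have "((\<lambda>t. L x t v) has_integral (1 * \<eta> (c x 1) v - 0 * \<eta> (c x 0) v)) {0..1}"
        by (rule fundamental_theorem_of_calculus[OF zero_le_one d])
      then have "((\<lambda>t. L x t v) has_integral \<eta> x v) (cbox 0 1)"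
        by (simp add: c_def)
      then show ?thesis using has_integral_unique[OF i1] by simp
    qed
    ultimately have "(F has_derivative \<eta> x) (at x within S)"
      by (intro has_derivative_eq_rhs[of F _ "at x within S" "\<eta> x"] ext)
    then show ?thesis unfolding at_within_open[OF x S(1)] .
  qed
  then show ?thesis using that by blast
qed

section \<open>Stokes' theorem on large boxes\<close>

text \<open>
  The hypotheses say that \<open>P dx \<and> dy - Q dy \<and> ds + R dx \<and> ds\<close> is a closed 2-form on a slab. Over the box of
  side \<open>N\<close>, the difference of the fluxes through top and bottom is at least \<open>(p - q) N\<^sup>2\<close>, while each
  of the four sides contributes at most \<open>K (s\<^sub>1 - s\<^sub>0) N\<close>. Since the slab is unbounded in \<open>x\<close>
  and \<open>y\<close>, this forces \<open>p \<le> q\<close>.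
\<close>

lemma flux_comparison:
  fixes P Q R P' Q' R' :: "real \<Rightarrow> real \<Rightarrow> real \<Rightarrow> real"
  assumes s: "s0 \<le> s1"
    and P: "\<And>x y s. s \<in> {s0..s1} \<Longrightarrow> (P x y has_real_derivative P' x y s) (at s)"
    and Q: "\<And>x y s. s \<in> {s0..s1} \<Longrightarrow> ((\<lambda>x. Q x y s) has_real_derivative Q' x y s) (at x)"
    and R: "\<And>x y s. s \<in> {s0..s1} \<Longrightarrow> ((\<lambda>y. R x y s) has_real_derivative R' x y s) (at y)"
    and cP: "continuous_on (UNIV \<times> UNIV \<times> {s0..s1}) (\<lambda>(x, y, s). P x y s)"
    and cQ: "continuous_on (UNIV \<times> UNIV \<times> {s0..s1}) (\<lambda>(x, y, s). Q' x y s)"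
    and cR: "continuous_on (UNIV \<times> UNIV \<times> {s0..s1}) (\<lambda>(x, y, s). R' x y s)"
    and div: "\<And>x y s. s \<in> {s0..s1} \<Longrightarrow> P' x y s = Q' x y s + R' x y s"
    and K: "\<And>x y s. s \<in> {s0..s1} \<Longrightarrow> \<bar>Q x y s\<bar> \<le> K" "\<And>x y s. s \<in> {s0..s1} \<Longrightarrow> \<bar>R x y s\<bar> \<le> K"
    and top: "\<And>x y. p \<le> P x y s1" and bot: "\<And>x y. P x y s0 \<le> q"
  shows "p \<le> q"
proof -
  have K0: "0 \<le> K" using K(1)[of s0 0 0] s by simp
  have bound: "(p - q) * N * N \<le> 4 * K * (s1 - s0) * N" if N: "N > 0" for N
  proof -
    let ?X = "cbox 0 N" and ?S = "cbox s0 s1"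
    let ?YS = "cbox (0, s0) (N, s1)"
    have sub: "cbox (0, (0, s0)) (N, (N, s1)) \<subseteq> UNIV \<times> UNIV \<times> {s0..s1}"
      by (auto simp: cbox_Pair_eq)
    have cQ': "continuous_on (cbox (0, (0, s0)) (N, (N, s1))) (\<lambda>(x, z). Q' x (fst z) (snd z))"
      using continuous_on_subset[OF cQ sub] by (simp add: case_prod_unfold)
    have cR': "continuous_on (cbox (0, (0, s0)) (N, (N, s1))) (\<lambda>(x, z). R' x (fst z) (snd z))"
      using continuous_on_subset[OF cR sub] by (simp add: case_prod_unfold)
    note c1 = cQ'[unfolded cbox_Pair_eq[of 0 "(0, s0)"]] cR'[unfolded cbox_Pair_eq[of 0 "(0, s0)"]]
    have slice: "continuous_on ?YS (\<lambda>z. f x (fst z) (snd z))"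
      if "continuous_on (UNIV \<times> UNIV \<times> {s0..s1}) (\<lambda>(x, y, s). f x y s)" for x and f :: "real \<Rightarrow> real \<Rightarrow> real \<Rightarrow> real"
    proof -
      have "continuous_on ?YS (\<lambda>z. case (x, fst z, snd z) of (x, y, s) \<Rightarrow> f x y s)"
        by (rule continuous_on_compose2[OF that]) (auto intro!: continuous_intros simp: cbox_Pair_eq)
      then show ?thesis by (simp only: prod.case)
    qed
    have cPs: "continuous_on ?X (\<lambda>y. P x y s)" if "s \<in> {s0..s1}" for x s
    proof -
      have "continuous_on ?X (\<lambda>y. case (x, y, s) of (x, y, s) \<Rightarrow> P x y s)"
        by (rule continuous_on_compose2[OF cP]) (use that in \<open>auto intro!: continuous_intros\<close>)
      then show ?thesis by (simp only: prod.case)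
    qed
    \<comment> \<open>The outer variable is \<open>x\<close>; the integrals of \<open>Q'\<close> and \<open>R'\<close> over the slices are kept apart,
      because they are evaluated in different orders.\<close>
    define IQ where "IQ x = integral ?YS (\<lambda>z. Q' x (fst z) (snd z))" for x
    define IR where "IR x = integral ?YS (\<lambda>z. R' x (fst z) (snd z))" for x
    have iQ: "IQ integrable_on ?X" and iR: "IR integrable_on ?X"
      unfolding IQ_def IR_def by (intro integrable_continuous integral_continuous_on_param c1)+
    have Ps: "integral ?X (\<lambda>y. P x y s1 - P x y s0) = IQ x + IR x" for x
    proof -
      have "IQ x + IR x = integral ?YS (\<lambda>z. Q' x (fst z) (snd z) + R' x (fst z) (snd z))"
        unfolding IQ_def IR_def
        by (intro integral_add[symmetric] integrable_continuous slice cQ cR)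
      also have "\<dots> = integral ?X (\<lambda>y. integral ?S (\<lambda>s. Q' x y s + R' x y s))"
        using integral_prod_continuous[OF continuous_on_add[OF slice[OF cQ] slice[OF cR]], of x x]
        by simp
      also have "\<dots> = integral ?X (\<lambda>y. P x y s1 - P x y s0)"
      proof (rule integral_cong)
        fix y
        have "((\<lambda>s. Q' x y s + R' x y s) has_integral (P x y s1 - P x y s0)) {s0..s1}"
          by (rule fundamental_theorem_of_calculus[OF s])
            (use P[of _ x y] div[of _ x y] in \<open>auto simp: has_real_derivative_iff_has_vector_derivative
              intro: has_vector_derivative_at_within\<close>)
        then show "integral ?S (\<lambda>s. Q' x y s + R' x y s) = P x y s1 - P x y s0"
          by (simp add: integral_unique)
      qed
      finally show ?thesis by simp
    qed
    have FQ: "integral ?X (\<lambda>x. Q' x (fst z) (snd z)) = Q N (fst z) (snd z) - Q 0 (fst z) (snd z)"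
      if "z \<in> ?YS" for z
    proof -
      have z: "snd z \<in> {s0..s1}" using that by (auto simp: cbox_Pair_eq)
      have "((\<lambda>x. Q' x (fst z) (snd z)) has_integral (Q N (fst z) (snd z) - Q 0 (fst z) (snd z))) {0..N}"
        by (rule fundamental_theorem_of_calculus)
          (use N Q[OF z, of "fst z"] in \<open>auto simp: has_real_derivative_iff_has_vector_derivative
              intro: has_vector_derivative_at_within\<close>)
      then show ?thesis by (simp add: integral_unique)
    qed
    have "integral ?X IQ = integral ?YS (\<lambda>z. integral ?X (\<lambda>x. Q' x (fst z) (snd z)))"
      unfolding IQ_def by (rule integral_swap_continuous[OF cQ'])
    then have eQ: "integral ?X IQ = integral ?YS (\<lambda>z. Q N (fst z) (snd z) - Q 0 (fst z) (snd z))"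
      using integral_cong[of ?YS, OF FQ] by simp
    have "(\<lambda>z. integral ?X (\<lambda>x. Q' x (fst z) (snd z))) integrable_on ?YS"
    proof (intro integrable_continuous integral_continuous_on_param)
      have "continuous_on (?YS \<times> ?X) (\<lambda>w. case (snd w, fst (fst w), snd (fst w)) of (x, y, s) \<Rightarrow> Q' x y s)"
        by (rule continuous_on_compose2[OF cQ]) (auto intro!: continuous_intros simp: cbox_Pair_eq)
      then show "continuous_on (?YS \<times> ?X) (\<lambda>(z, x). Q' x (fst z) (snd z))"
        by (simp add: case_prod_unfold)
    qed
    then have "(\<lambda>z. Q N (fst z) (snd z) - Q 0 (fst z) (snd z)) integrable_on ?YS"
      by (rule integrable_eq) (rule FQ)
    then have "norm (integral ?YS (\<lambda>z. Q N (fst z) (snd z) - Q 0 (fst z) (snd z))) \<le> (2 * K) * measure lborel ?YS"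
    proof (intro has_integral_bound[OF _ integrable_integral])
      fix z assume "z \<in> ?YS"
      then have z: "snd z \<in> {s0..s1}" by (auto simp: cbox_Pair_eq)
      show "norm (Q N (fst z) (snd z) - Q 0 (fst z) (snd z)) \<le> 2 * K"
        using K(1)[OF z, of N "fst z"] K(1)[OF z, of 0 "fst z"] by simp
    qed (use K0 in auto)
    then have bQ: "integral ?X IQ \<le> 2 * K * (N * (s1 - s0))"
      using N s unfolding eQ[symmetric] by (simp add: content_Pair abs_le_iff)
    \<comment> \<open>For \<open>R'\<close> the variable \<open>y\<close> has to be integrated first, so only the inner two integrals are
      exchanged.\<close>
    have IR: "norm (IR x) \<le> 2 * K * (s1 - s0)" for x
    proof -
      have c: "continuous_on ?YS (\<lambda>(y, s). R' x y s)" using slice[OF cR, of x] by (simp add: case_prod_unfold)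
      have "IR x = integral ?X (\<lambda>y. integral ?S (R' x y))"
        unfolding IR_def by (subst integral_prod_continuous) (auto intro: slice cR)
      also have "\<dots> = integral ?S (\<lambda>s. integral ?X (\<lambda>y. R' x y s))"
        by (rule integral_swap_continuous[OF c])
      finally have e: "IR x = \<dots>" .
      have "norm (integral ?S (\<lambda>s. integral ?X (\<lambda>y. R' x y s))) \<le> (2 * K) * measure lborel ?S"
      proof (intro has_integral_bound[OF _ integrable_integral] integrable_continuous integral_continuous_on_param)
        have "continuous_on (?S \<times> ?X) (\<lambda>w. case (x, snd w, fst w) of (x, y, s) \<Rightarrow> R' x y s)"
          by (rule continuous_on_compose2[OF cR]) (auto intro!: continuous_intros)
        then show "continuous_on (?S \<times> ?X) (\<lambda>(s, y). R' x y s)"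
          by (simp add: case_prod_unfold)
        fix s assume "s \<in> ?S"
        then have s': "s \<in> {s0..s1}" by simp
        have "((\<lambda>y. R' x y s) has_integral (R x N s - R x 0 s)) {0..N}"
          by (rule fundamental_theorem_of_calculus)
            (use N R[OF s', of x] in \<open>auto simp: has_real_derivative_iff_has_vector_derivative
                intro: has_vector_derivative_at_within\<close>)
        then show "norm (integral ?X (\<lambda>y. R' x y s)) \<le> 2 * K"
          using K(2)[OF s', of x N] K(2)[OF s', of x 0] by (simp add: integral_unique)
      qed (use K0 in auto)
      then show ?thesis using s by (simp add: e)
    qed
    have "norm (integral ?X IR) \<le> (2 * K * (s1 - s0)) * measure lborel ?X"
      by (intro has_integral_bound[OF _ integrable_integral[OF iR]]) (use IR K0 s in auto)
    then have bR: "integral ?X IR \<le> 2 * K * (s1 - s0) * N" using N by simp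
    have "(p - q) * N \<le> IQ x + IR x" for x
    proof -
      have "integral ?X (\<lambda>y. p - q) \<le> integral ?X (\<lambda>y. P x y s1 - P x y s0)"
      proof (intro integral_le integrable_continuous continuous_intros cPs)
        show "p - q \<le> P x y s1 - P x y s0" for y using top[of x y] bot[of x y] by simp
      qed (use s in auto)
      then show ?thesis using N unfolding Ps by (simp add: mult.commute)
    qed
    then have "integral ?X (\<lambda>x. (p - q) * N) \<le> integral ?X (\<lambda>x. IQ x + IR x)"
      by (intro integral_le integrable_add iQ iR) auto
    then have "(p - q) * N * N \<le> integral ?X IQ + integral ?X IR"
      using N unfolding integral_add[OF iQ iR] by (simp add: mult_ac)
    then show ?thesis using bQ bR by (simp add: algebra_simps)
  qed
  show ?thesis
  proof (rule ccontr)
    assume "\<not> p \<le> q"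
    then have pq: "p - q > 0" by simp
    define N where "N = (4 * K * (s1 - s0) + 1) / (p - q)"
    have N: "N > 0" unfolding N_def using pq K0 s by (intro divide_pos_pos add_nonneg_pos) auto
    have "(p - q) * N \<le> 4 * K * (s1 - s0)" using bound[OF N] N by simp
    then show False using pq by (simp add: N_def)
  qed
qed

section \<open>Equality of de Rham classes\<close>

lemma deRham_class1_eqI:
  assumes op: "\<And>c. c \<in> \<A> \<Longrightarrow> open (chart_range c)"
    and f: "smooth_function \<A> f"
    and df: "\<And>c x v. c \<in> \<A> \<Longrightarrow> x \<in> chart_range c \<Longrightarrow>
      \<eta> c x v - \<theta> c x v = ext_d0 (f \<circ> chart_inv c) x v"
  shows "deRham_class1 \<A> \<eta> = deRham_class1 \<A> \<theta>"
proof -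
  have shift: "smooth_function \<A> (\<lambda>q. h q + k * f q) \<and> (\<forall>c\<in>\<A>. \<forall>x\<in>chart_range c. \<forall>v.
      ext_d0 ((\<lambda>q. h q + k * f q) \<circ> chart_inv c) x v =
      ext_d0 (h \<circ> chart_inv c) x v + k * ext_d0 (f \<circ> chart_inv c) x v)"
    if h: "smooth_function \<A> h" for h k
  proof (intro conjI ballI allI)
    have eq: "(\<lambda>q. h q + k * f q) \<circ> chart_inv c = (\<lambda>x. (h \<circ> chart_inv c) x + k * (f \<circ> chart_inv c) x)" for c
      by (simp add: fun_eq_iff)
    show "smooth_function \<A> (\<lambda>q. h q + k * f q)"
      unfolding smooth_function_def eq
      by (intro ballI smooth_on_add_scaled op f[unfolded smooth_function_def, rule_format]
          h[unfolded smooth_function_def, rule_format])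
    fix c x v assume c: "c \<in> \<A>" and x: "x \<in> chart_range c"
    have "(h \<circ> chart_inv c has_derivative ext_d0 (h \<circ> chart_inv c) x) (at x)"
      "(f \<circ> chart_inv c has_derivative ext_d0 (f \<circ> chart_inv c) x) (at x)"
      using f h c x smooth_on_has_derivative unfolding ext_d0_def[abs_def] smooth_function_def by blast+
    from has_derivative_add[OF this(1) has_derivative_mult_right[OF this(2)]]
    have "((\<lambda>x. (h \<circ> chart_inv c) x + k * (f \<circ> chart_inv c) x) has_derivative
      (\<lambda>v. ext_d0 (h \<circ> chart_inv c) x v + k * ext_d0 (f \<circ> chart_inv c) x v)) (at x)" .
    from frechet_derivative_at[OF this]
    show "ext_d0 ((\<lambda>q. h q + k * f q) \<circ> chart_inv c) x v =
      ext_d0 (h \<circ> chart_inv c) x v + k * ext_d0 (f \<circ> chart_inv c) x v"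
      unfolding eq ext_d0_def[of "\<lambda>x. (h \<circ> chart_inv c) x + k * (f \<circ> chart_inv c) x"] by metis
  qed
  show ?thesis
  proof (intro equalityI subsetI)
    fix \<zeta> assume "\<zeta> \<in> deRham_class1 \<A> \<eta>"
    then obtain h where \<zeta>: "closed_one_form \<A> \<zeta>" and h: "smooth_function \<A> h"
      "\<And>c x v. c \<in> \<A> \<Longrightarrow> x \<in> chart_range c \<Longrightarrow> \<zeta> c x v - \<eta> c x v = ext_d0 (h \<circ> chart_inv c) x v"
      unfolding deRham_class1_def by blast
    have "\<zeta> c x v - \<theta> c x v = ext_d0 ((\<lambda>q. h q + 1 * f q) \<circ> chart_inv c) x v"
      if c: "c \<in> \<A>" "x \<in> chart_range c" for c x v
    proof -
      have "ext_d0 ((\<lambda>q. h q + 1 * f q) \<circ> chart_inv c) x v =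
          ext_d0 (h \<circ> chart_inv c) x v + 1 * ext_d0 (f \<circ> chart_inv c) x v"
        using shift[OF h(1), of 1] c by blast
      then show ?thesis using h(2)[OF c, of v] df[OF c, of v] by linarith
    qed
    then show "\<zeta> \<in> deRham_class1 \<A> \<theta>"
      unfolding deRham_class1_def using \<zeta> shift[OF h(1), of 1] by blast
  next
    fix \<zeta> assume "\<zeta> \<in> deRham_class1 \<A> \<theta>"
    then obtain h where \<zeta>: "closed_one_form \<A> \<zeta>" and h: "smooth_function \<A> h"
      "\<And>c x v. c \<in> \<A> \<Longrightarrow> x \<in> chart_range c \<Longrightarrow> \<zeta> c x v - \<theta> c x v = ext_d0 (h \<circ> chart_inv c) x v"
      unfolding deRham_class1_def by blast
    have "\<zeta> c x v - \<eta> c x v = ext_d0 ((\<lambda>q. h q + (- 1) * f q) \<circ> chart_inv c) x v"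
      if c: "c \<in> \<A>" "x \<in> chart_range c" for c x v
    proof -
      have "ext_d0 ((\<lambda>q. h q + (- 1) * f q) \<circ> chart_inv c) x v =
          ext_d0 (h \<circ> chart_inv c) x v + (- 1) * ext_d0 (f \<circ> chart_inv c) x v"
        using shift[OF h(1), of "- 1"] c by blast
      then show ?thesis using h(2)[OF c, of v] df[OF c, of v] by linarith
    qed
    then show "\<zeta> \<in> deRham_class1 \<A> \<eta>"
      unfolding deRham_class1_def using \<zeta> shift[OF h(1), of "- 1"] by blast
  qed
qed

section \<open>Tensor fields lifted to the universal cover\<close>

definition inoue_aff_deriv :: "real \<Rightarrow> complex \<Rightarrow> int \<Rightarrow> complex \<times> complex \<Rightarrow> complex \<times> complex" where
  "inoue_aff_deriv \<alpha> \<beta> k v = (\<beta> powi k * fst v, of_real (\<alpha> powi k) * snd v)"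

text \<open>The open sets on which the projection is injective: they are the ranges of the charts.\<close>

definition inoue_slice :: "real \<Rightarrow> complex \<Rightarrow> real^3 \<Rightarrow> complex^3 \<Rightarrow> (complex \<times> complex) set \<Rightarrow> bool" where
  "inoue_slice \<alpha> \<beta> a b U \<longleftrightarrow> open U \<and> U \<subseteq> CH \<and> inj_on (inoue_proj \<alpha> \<beta> a b) U"

definition inoue_chart :: "real \<Rightarrow> complex \<Rightarrow> real^3 \<Rightarrow> complex^3 \<Rightarrow> (complex \<times> complex) set \<Rightarrow>
    ((complex \<times> complex) set, complex \<times> complex) chart" where
  "inoue_chart \<alpha> \<beta> a b U = (inoue_proj \<alpha> \<beta> a b ` U, inv_into U (inoue_proj \<alpha> \<beta> a b))"

text \<open>
  The pullback of a field under the projection. Every chart is a local inverse of the projection, so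
  the pullback at \<open>x\<close> is the coordinate expression at \<open>x\<close> in any chart whose range contains \<open>x\<close>;
  the result type leaves the rank of the field open.
\<close>

definition inoue_lift :: "real \<Rightarrow> complex \<Rightarrow> real^3 \<Rightarrow> complex^3 \<Rightarrow>
    (((complex \<times> complex) set, complex \<times> complex) chart \<Rightarrow> complex \<times> complex \<Rightarrow> 'r) \<Rightarrow>
    complex \<times> complex \<Rightarrow> 'r" where
  "inoue_lift \<alpha> \<beta> a b \<phi> x =
     \<phi> (inoue_chart \<alpha> \<beta> a b (SOME U. inoue_slice \<alpha> \<beta> a b U \<and> x \<in> U)) x"

lemma inoue_atlas_iff:
  "c \<in> inoue_atlas \<alpha> \<beta> a b \<longleftrightarrow> (\<exists>U. inoue_slice \<alpha> \<beta> a b U \<and> c = inoue_chart \<alpha> \<beta> a b U)"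
  by (auto simp: inoue_atlas_def inoue_slice_def inoue_chart_def)

lemma inoue_chart_range: "inoue_slice \<alpha> \<beta> a b U \<Longrightarrow> chart_range (inoue_chart \<alpha> \<beta> a b U) = U"
  by (simp add: inoue_slice_def chart_range_def inoue_chart_def)

lemma inoue_chart_inv:
  assumes "inoue_slice \<alpha> \<beta> a b U" "x \<in> U"
  shows "chart_inv (inoue_chart \<alpha> \<beta> a b U) x = inoue_proj \<alpha> \<beta> a b x"
proof -
  let ?p = "inoue_proj \<alpha> \<beta> a b"
  have "inj_on (inv_into U ?p) (?p ` U)" by (rule inj_on_inv_into) simp
  then show ?thesis
    using assms by (simp add: inoue_slice_def chart_inv_def inoue_chart_def inv_into_f_eq)
qed

lemma CH_iff: "x \<in> CH \<longleftrightarrow> 0 < Im (snd x)"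
  by (cases x) (simp add: CH_def)

lemma convex_CH: "convex CH"
  unfolding CH_def by (intro convex_Times convex_UNIV convex_halfspace_Im_gt)

lemma inoue_aff_Im: "Im (snd (inoue_aff \<alpha> \<beta> k s t x)) = \<alpha> powi k * Im (snd x)"
  by (simp add: inoue_aff_def split_beta del: of_real_power_int)

lemma inoue_aff_0_eq: "inoue_aff \<alpha> \<beta> 0 s t x = x + (s, of_real t)"
  by (simp add: inoue_aff_def split_beta prod_eq_iff)

lemma inoue_aff_deriv_0: "inoue_aff_deriv \<alpha> \<beta> 0 v = v"
  by (simp add: inoue_aff_deriv_def)

locale inoue =
  fixes A :: "int^3^3" and \<alpha> :: real and \<beta> :: complex and a :: "real^3" and b :: "complex^3"
  assumes D: "inoue_data A \<alpha> \<beta> a b"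
begin

abbreviation "proj \<equiv> inoue_proj \<alpha> \<beta> a b"
abbreviation "aff \<equiv> inoue_aff \<alpha> \<beta>"
abbreviation "daff \<equiv> inoue_aff_deriv \<alpha> \<beta>"
abbreviation "atlas \<equiv> inoue_atlas \<alpha> \<beta> a b"
abbreviation "chart \<equiv> inoue_chart \<alpha> \<beta> a b"
abbreviation "slice \<equiv> inoue_slice \<alpha> \<beta> a b"
abbreviation "lat \<equiv> inoue_lattice a b"
abbreviation "lift \<equiv> inoue_lift \<alpha> \<beta> a b"

lemma proj_generator: "h \<in> inoue_generators \<alpha> \<beta> a b \<Longrightarrow> x \<in> CH \<Longrightarrow> proj (h x) = proj x"
  by (rule proj_group[OF D]) (rule generate.incl)

text \<open>
  The pairs \<open>(s, t)\<close> whose translation preserves the fibres of the projection form a group, which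
  contains the generators of the lattice.
\<close>

lemma proj_translation:
  assumes "(s, t) \<in> lat" "x \<in> CH"
  shows "proj (aff 0 s t x) = proj x"
proof -
  define H where "H = {(s, t). \<forall>x\<in>CH. proj (aff 0 s t x) = proj x}"
  have HI: "(s, t) \<in> H \<longleftrightarrow> (\<forall>x\<in>CH. proj (aff 0 s t x) = proj x)" for s t by (simp add: H_def)
  have mem: "aff 0 s t x \<in> CH" if "x \<in> CH" for s t x by (rule inoue_aff_CH[OF D that])
  have comp: "aff 0 s t (aff 0 s' t' x) = aff 0 (s + s') (t + t') x" for s t s' t' x
    by (simp add: inoue_aff_0_eq)
  have H0: "(0, 0) \<in> H" unfolding HI by (simp add: inoue_aff_0_eq flip: zero_prod_def)
  have add: "(s + s', t + t') \<in> H" if "(s, t) \<in> H" "(s', t') \<in> H" for s t s' t'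
    using that mem unfolding HI comp[symmetric] by simp
  have neg: "(- s, - t) \<in> H" if st: "(s, t) \<in> H" for s t
  proof -
    have "proj (aff 0 (- s) (- t) x) = proj (aff 0 s t (aff 0 (- s) (- t) x))" if "x \<in> CH" for x
      using st mem[OF that] unfolding HI by simp
    then show ?thesis unfolding HI comp by (simp add: inoue_aff_0_eq flip: zero_prod_def)
  qed
  have gen: "(b $ i, a $ i) \<in> H" for i
    unfolding HI
  proof
    fix x assume x: "x \<in> CH"
    let ?h = "\<lambda>(z, w)\<in>CH. (z + b $ i, w + of_real (a $ i))"
    have "proj (?h x) = proj x"
      by (rule proj_generator[OF _ x, unfolded inoue_generators_def]) (rule insertI2[OF rangeI])
    then show "proj (aff 0 (b $ i) (a $ i) x) = proj x"
      using x by (simp add: inoue_aff_def)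
  qed
  have mul: "(of_int m * s, of_int m * t) \<in> H" if st: "(s, t) \<in> H" for m s t
  proof (induction m rule: int_induct[where k=0])
    case base show ?case using H0 by simp
  next
    case (step1 i) show ?case using add[OF step1(2) st] by (simp add: distrib_right)
  next
    case (step2 i) show ?case using add[OF step2(2) neg[OF st]] by (simp add: left_diff_distrib)
  qed
  obtain n :: "int^3" where
    "s = (\<Sum>i\<in>UNIV. of_int (n $ i) * b $ i)" "t = (\<Sum>i\<in>UNIV. of_int (n $ i) * a $ i)"
    using assms(1) unfolding inoue_lattice_def by blast
  then have "(s, t) \<in> H"
    unfolding sum_3 by (auto intro!: add mul gen)
  then show ?thesis using assms(2) unfolding HI by simp
qed

lemma proj_aff:
  assumes "(s, t) \<in> lat" "x \<in> CH"
  shows "proj (aff k s t x) = proj x"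
proof -
  have mem: "aff k s t x \<in> CH" if "x \<in> CH" for k s t x by (rule inoue_aff_CH[OF D that])
  have one: "proj (aff 1 0 0 x) = proj x" if x: "x \<in> CH" for x
  proof -
    let ?h = "\<lambda>(z, w)\<in>CH. (\<beta> * z, of_real \<alpha> * w)"
    have "proj (?h x) = proj x"
      by (rule proj_generator[OF _ x, unfolded inoue_generators_def]) (rule insertI1)
    then show ?thesis using x by (simp add: inoue_aff_def)
  qed
  have S: "aff 1 0 0 (aff l 0 0 x) = aff (l + 1) 0 0 x" for l x
    by (simp add: inoue_aff_comp[OF D] add.commute)
  have "proj (aff k 0 0 x) = proj x"
  proof (induction k rule: int_induct[where k=0])
    case base show ?case by (simp add: inoue_aff_0[OF D])
  next
    case (step1 i) show ?case using one[OF mem[OF assms(2)], of i 0 0] step1 by (simp add: S)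
  next
    case (step2 i) show ?case using one[OF mem[OF assms(2)], of "i - 1" 0 0] step2 by (simp add: S)
  qed
  moreover have "aff k s t x = aff 0 s t (aff k 0 0 x)"
    by (simp add: inoue_aff_comp[OF D])
  ultimately show ?thesis using proj_translation[OF assms(1) mem[OF assms(2)]] by simp
qed

lemma aff_has_derivative: "(aff k s t has_derivative daff k) (at x)"
  using inoue_aff_has_derivative[OF D] by (simp only: inoue_aff_deriv_def[abs_def])

lemma slice_around:
  assumes "x \<in> CH" obtains U where "slice U" "x \<in> U"
  using inoue_evenly_covered[OF D assms] unfolding inoue_slice_def by metis

text \<open>
  Both charts invert the projection, so where a deck transformation maps the first range into the
  second one it is the transition map. The identity among the deck transformations shows that lifts do
  not depend on the chart, the others show that lifts are invariant.
\<close>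

lemma transition_aff:
  assumes U: "slice U" and V: "slice V" and st: "(s, t) \<in> lat"
    and x: "x \<in> U" and y: "aff k s t x \<in> V"
  shows "x \<in> overlap (chart U) (chart V)"
    and "transition (chart U) (chart V) x = aff k s t x"
    and "transition_deriv (chart U) (chart V) x = daff k"
proof -
  have UC: "U \<subseteq> CH" "open U" "inj_on proj U" and VC: "open V" "inj_on proj V" 
    using U V by (auto simp: inoue_slice_def)
  have T: "transition (chart U) (chart V) z = aff k s t z" if z: "z \<in> U" "aff k s t z \<in> V" for z
  proof -
    have "proj z = proj (aff k s t z)" by (rule proj_aff[OF st subsetD[OF UC(1) z(1)], symmetric])
    then have "transition (chart U) (chart V) z = inv_into V proj (proj (aff k s t z))"
      by (simp add: transition_def inoue_chart_inv[OF U z(1)]) (simp add: inoue_chart_def)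
    then show ?thesis using VC(2) z(2) by simp
  qed
  show "transition (chart U) (chart V) x = aff k s t x" using T x y .
  have "proj x \<in> proj ` V" using proj_aff[OF st, of x k] x y UC by (metis imageI subsetD)
  moreover have "inv_into U proj (proj x) = x" using UC(3) x by simp
  ultimately show "x \<in> overlap (chart U) (chart V)"
    unfolding overlap_def inoue_chart_def fst_conv snd_conv using x by (metis IntI imageI)
  have "open (U \<inter> aff k s t -` V)"
    by (intro open_Int UC open_vimage VC)
      (auto simp: inoue_aff_def split_beta intro!: continuous_intros)
  then have "(transition (chart U) (chart V) has_derivative daff k) (at x)"
    by (rule has_derivative_transform_within_open[OF aff_has_derivative]) (use x y T in auto)
  then show "transition_deriv (chart U) (chart V) x = daff k"
    by (rule frechet_derivative_at[symmetric])
qed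

lemma lift_chart:
  assumes "x \<in> CH"
  obtains U where "slice U" "x \<in> U" "lift \<phi> x = \<phi> (chart U) x"
proof -
  have "\<exists>U. slice U \<and> x \<in> U" using slice_around[OF assms] by blast
  from someI_ex[OF this] show ?thesis by (intro that) (auto simp: inoue_lift_def)
qed

lemma chart_in_atlas: "slice U \<Longrightarrow> chart U \<in> atlas"
  unfolding inoue_atlas_iff by blast

lemma slice_CH: "slice U \<Longrightarrow> x \<in> U \<Longrightarrow> x \<in> CH"
  by (auto simp: inoue_slice_def)

lemma one_form_lift_eq:
  assumes \<eta>: "one_form atlas \<eta>" and U: "slice U" "x \<in> U"
  shows "lift \<eta> x = \<eta> (chart U) x"
proof
  fix v
  obtain V where V: "slice V" "x \<in> V" "lift \<eta> x = \<eta> (chart V) x"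
    using lift_chart[OF slice_CH[OF U]] .
  have "aff 0 0 0 x \<in> U" using U by (simp add: inoue_aff_0[OF D])
  note tr = transition_aff[OF V(1) U(1) inoue_lattice_0 V(2) this]
  have "\<eta> (chart V) x v = \<eta> (chart U) (transition (chart V) (chart U) x) (transition_deriv (chart V) (chart U) x v)"
    using \<eta> tr(1) chart_in_atlas[OF U(1)] chart_in_atlas[OF V(1)] unfolding one_form_def by blast
  then show "lift \<eta> x v = \<eta> (chart U) x v"
    by (simp add: V(3) tr(2,3) inoue_aff_0[OF D] inoue_aff_deriv_0)
qed

lemma one_form_lift_invariant:
  assumes \<eta>: "one_form atlas \<eta>" and x: "x \<in> CH" and st: "(s, t) \<in> lat"
  shows "lift \<eta> (aff k s t x) (daff k v) = lift \<eta> x v"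
proof -
  obtain U where U: "slice U" "x \<in> U" using slice_around[OF x] .
  obtain V where V: "slice V" "aff k s t x \<in> V" using slice_around[OF inoue_aff_CH[OF D x]] .
  note tr = transition_aff[OF U(1) V(1) st U(2) V(2)]
  have "\<eta> (chart U) x v = \<eta> (chart V) (transition (chart U) (chart V) x) (transition_deriv (chart U) (chart V) x v)"
    using \<eta> tr(1) chart_in_atlas[OF U(1)] chart_in_atlas[OF V(1)] unfolding one_form_def by blast
  then show ?thesis by (simp add: tr(2,3) one_form_lift_eq[OF \<eta> U] one_form_lift_eq[OF \<eta> V])
qed

lemma bilinear_field_lift_eq:
  assumes g: "bilinear_field atlas g" and U: "slice U" "x \<in> U"
  shows "lift g x = g (chart U) x"
proof (intro ext)
  fix u v
  obtain V where V: "slice V" "x \<in> V" "lift g x = g (chart V) x"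
    using lift_chart[OF slice_CH[OF U]] .
  have "aff 0 0 0 x \<in> U" using U by (simp add: inoue_aff_0[OF D])
  note tr = transition_aff[OF V(1) U(1) inoue_lattice_0 V(2) this]
  have "g (chart V) x u v = g (chart U) (transition (chart V) (chart U) x)
      (transition_deriv (chart V) (chart U) x u) (transition_deriv (chart V) (chart U) x v)"
    using g tr(1) chart_in_atlas[OF U(1)] chart_in_atlas[OF V(1)] unfolding bilinear_field_def by blast
  then show "lift g x u v = g (chart U) x u v"
    by (simp add: V(3) tr(2,3) inoue_aff_0[OF D] inoue_aff_deriv_0)
qed

lemma bilinear_field_lift_invariant:
  assumes g: "bilinear_field atlas g" and x: "x \<in> CH" and st: "(s, t) \<in> lat"
  shows "lift g (aff k s t x) (daff k u) (daff k v) = lift g x u v"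
proof -
  obtain U where U: "slice U" "x \<in> U" using slice_around[OF x] .
  obtain V where V: "slice V" "aff k s t x \<in> V" using slice_around[OF inoue_aff_CH[OF D x]] .
  note tr = transition_aff[OF U(1) V(1) st U(2) V(2)]
  have "g (chart U) x u v = g (chart V) (transition (chart U) (chart V) x)
      (transition_deriv (chart U) (chart V) x u) (transition_deriv (chart U) (chart V) x v)"
    using g tr(1) chart_in_atlas[OF U(1)] chart_in_atlas[OF V(1)] unfolding bilinear_field_def by blast
  then show ?thesis by (simp add: tr(2,3) bilinear_field_lift_eq[OF g U] bilinear_field_lift_eq[OF g V])
qed

lemma smooth_on_CH_local:
  assumes "\<And>U. slice U \<Longrightarrow> smooth_on (h U) U" "\<And>U x. slice U \<Longrightarrow> x \<in> U \<Longrightarrow> h U x = f x"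
  shows "smooth_on f CH"
  unfolding smooth_on_def
proof (intro allI Ck_on_local)
  fix k and x :: "complex \<times> complex" assume "x \<in> CH"
  then obtain U where U: "slice U" "x \<in> U" by (rule slice_around)
  then show "\<exists>U h. open U \<and> x \<in> U \<and> Ck_on k h U \<and> (\<forall>y\<in>U. h y = f y)"
    using assms[OF U(1)] by (intro exI[of _ U] exI[of _ "h U"]) (auto simp: smooth_on_def inoue_slice_def)
qed

lemma slice_derivative:
  assumes "slice U" "x \<in> U" "smooth_on h U" "\<And>y. y \<in> U \<Longrightarrow> h y = f y"
  shows "frechet_derivative f (at x) = frechet_derivative h (at x)"
  using assms smooth_on_has_derivative[OF assms(3,2)]
  by (intro frechet_derivative_local(2)[where U=U]) (auto simp: inoue_slice_def intro: differentiableI)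

lemma closed_one_form_lift:
  assumes "closed_one_form atlas \<eta>"
  shows "x \<in> CH \<Longrightarrow> linear (lift \<eta> x)"
    and "smooth_on (\<lambda>x. lift \<eta> x v) CH"
    and "x \<in> CH \<Longrightarrow> ext_d1 (lift \<eta>) x u v = 0"
proof -
  have \<eta>: "one_form atlas \<eta>" using assms by (simp add: closed_one_form_def)
  note eq = one_form_lift_eq[OF \<eta>]
  have sm: "smooth_on (\<lambda>x. \<eta> (chart U) x v) U" if "slice U" for U v
    using \<eta> chart_in_atlas[OF that] inoue_chart_range[OF that] unfolding one_form_def by metis
  show "smooth_on (\<lambda>x. lift \<eta> x v) CH"
    by (rule smooth_on_CH_local[OF sm]) (simp_all add: eq)
  assume x: "x \<in> CH"
  obtain U where U: "slice U" "x \<in> U" using slice_around[OF x] .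
  have xr: "x \<in> chart_range (chart U)" using U inoue_chart_range by blast
  show "linear (lift \<eta> x)"
    using \<eta> chart_in_atlas[OF U(1)] xr unfolding eq[OF U] one_form_def by blast
  have "frechet_derivative (\<lambda>y. lift \<eta> y v) (at x) = frechet_derivative (\<lambda>y. \<eta> (chart U) y v) (at x)" for v
    by (rule slice_derivative[OF U sm[OF U(1)]]) (simp add: eq[OF U(1)])
  then have "ext_d1 (lift \<eta>) x u v = ext_d1 (\<eta> (chart U)) x u v"
    by (simp add: ext_d1_def)
  then show "ext_d1 (lift \<eta>) x u v = 0"
    using assms chart_in_atlas[OF U(1)] xr unfolding closed_one_form_def by simp
qed

lemma hermitian_metric_lift:
  assumes "hermitian_metric atlas g"
  shows "smooth_on (\<lambda>x. lift g x u v) CH"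
    and "x \<in> CH \<Longrightarrow> bilinear (lift g x)"
    and "x \<in> CH \<Longrightarrow> lift g x u v = lift g x v u"
    and "x \<in> CH \<Longrightarrow> lift g x (J u) (J v) = lift g x u v"
    and "x \<in> CH \<Longrightarrow> u \<noteq> 0 \<Longrightarrow> 0 < lift g x u u"
proof -
  have g: "bilinear_field atlas g" using assms by (simp add: hermitian_metric_def)
  note eq = bilinear_field_lift_eq[OF g]
  have sm: "smooth_on (\<lambda>x. g (chart U) x u v) U" if "slice U" for U u v
    using g chart_in_atlas[OF that] inoue_chart_range[OF that] unfolding bilinear_field_def by metis
  show "smooth_on (\<lambda>x. lift g x u v) CH"
    by (rule smooth_on_CH_local[OF sm]) (simp_all add: eq)
  assume x: "x \<in> CH"
  obtain U where U: "slice U" "x \<in> U" using slice_around[OF x] .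
  have xr: "x \<in> chart_range (chart U)" using U inoue_chart_range by blast
  show "bilinear (lift g x)"
    using g chart_in_atlas[OF U(1)] xr unfolding eq[OF U] bilinear_field_def by blast
  show "lift g x u v = lift g x v u" "lift g x (J u) (J v) = lift g x u v"
    using assms chart_in_atlas[OF U(1)] xr unfolding eq[OF U] hermitian_metric_def by blast+
  assume "u \<noteq> 0"
  then show "0 < lift g x u u"
    using assms chart_in_atlas[OF U(1)] xr unfolding eq[OF U] hermitian_metric_def by blast
qed

lemma LCK_metric_lift:
  assumes "LCK_metric atlas g \<eta>" and x: "x \<in> CH"
  shows "ext_d2 (\<lambda>y u v. lift g y (J u) v) x u v w =
    wedge12 (lift \<eta> x) (\<lambda>u v. lift g x (J u) v) u v w"
proof -
  have g: "bilinear_field atlas g" and \<eta>: "one_form atlas \<eta>"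
    using assms by (simp_all add: LCK_metric_def hermitian_metric_def closed_one_form_def)
  note eq = bilinear_field_lift_eq[OF g]
  have sm: "smooth_on (\<lambda>x. g (chart U) x u v) U" if "slice U" for U u v
    using g chart_in_atlas[OF that] inoue_chart_range[OF that] unfolding bilinear_field_def by metis
  obtain U where U: "slice U" "x \<in> U" using slice_around[OF x] .
  have xr: "x \<in> chart_range (chart U)" using U inoue_chart_range by blast
  have "frechet_derivative (\<lambda>y. lift g y u v) (at x) = frechet_derivative (\<lambda>y. g (chart U) y u v) (at x)" for u v
    by (rule slice_derivative[OF U sm[OF U(1)]]) (simp add: eq[OF U(1)])
  then have "ext_d2 (\<lambda>y u v. lift g y (J u) v) x u v w = ext_d2 (fundamental_form g (chart U)) x u v w"
    by (simp add: ext_d2_def fundamental_form_def)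
  also have "\<dots> = wedge12 (\<eta> (chart U) x) (fundamental_form g (chart U) x) u v w"
    using assms(1) chart_in_atlas[OF U(1)] xr unfolding LCK_metric_def by blast
  finally show ?thesis
    by (simp add: wedge12_def fundamental_form_def eq[OF U] one_form_lift_eq[OF \<eta> U])
qed

end

section \<open>Periodicity and the eigenvalues\<close>

text \<open>
  Since \<open>J\<close> is skew with respect to \<open>h\<close>, the vectors \<open>v\<close> and \<open>Jv\<close> are orthogonal and have the
  same length.
\<close>

lemma hermitian_complex_scaling:
  assumes "bilinear h" and sym: "\<And>u v. h u v = h v u" and J: "\<And>u v. h (J u) (J v) = h u v"
  shows "h (\<zeta> * z, \<zeta> * w) (\<zeta> * z, \<zeta> * w) = (cmod \<zeta>)\<^sup>2 * (h (z, w) (z, w) :: real)"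
proof -
  define v where "v = (z, w)"
  have eq: "(\<zeta> * z, \<zeta> * w) = Re \<zeta> *\<^sub>R v + Im \<zeta> *\<^sub>R J v"
    by (simp add: v_def J_def complex_eq_iff algebra_simps)
  have "J (J v) = - v" by (simp add: v_def J_def prod_eq_iff mult.assoc[symmetric])
  then have "h v (J v) = - h (J v) v"
    using J[of v "J v"] bilinear_rneg[OF assms(1)] by simp
  then have 0: "h v (J v) = 0" "h (J v) v = 0" using sym[of v "J v"] by simp_all
  show ?thesis
    unfolding eq v_def[symmetric] bilinear_ladd[OF assms(1)] bilinear_radd[OF assms(1)]
      bilinear_lmul[OF assms(1)] bilinear_rmul[OF assms(1)] J 0 cmod_power2
    by (simp add: power2_eq_square algebra_simps)
qed

lemma powers_bounded_imp_one:
  fixes r m M :: real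
  assumes "0 < r" "0 < m" and "\<And>n. m * r ^ n \<le> M" "\<And>n. m \<le> M * r ^ n"
  shows "r = 1"
proof (rule ccontr)
  assume "r \<noteq> 1"
  then consider "1 < r" | "r < 1" by linarith
  then show False
  proof cases
    case 1
    then obtain n where "M / m < r ^ n" using real_arch_pow[OF 1] by blast
    then have "M < m * r ^ n" using assms(2) by (simp add: pos_divide_less_eq mult.commute)
    then show False using assms(3)[of n] by simp
  next
    case 2
    have "0 < M" using assms(2) assms(4)[of 0] by simp
    then obtain n where "r ^ n < m / M" using real_arch_pow_inv[OF _ 2, of "m / M"] assms(2) by auto
    then have "M * r ^ n < m" using \<open>0 < M\<close> by (simp add: pos_less_divide_eq mult.commute)
    then show False using assms(4)[of n] by simp
  qed
qed

context inoue begin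

lemma char_poly_\<alpha>: "\<alpha> * (\<alpha> * \<alpha> - of_int (inoue_tr1 A) * \<alpha> + of_int (inoue_tr2 A)) = 1"
  using char_poly[OF D eig_a[OF D] eigvec_a_nonzero[OF D]] .

lemma char_poly_\<beta>: "\<beta> * (\<beta> * \<beta> - of_int (inoue_tr1 A) * \<beta> + of_int (inoue_tr2 A)) = 1"
  using char_poly[OF D eig_b[OF D] eigvec_b_nonzero[OF D]] .

lemma beta_neq_real: "\<beta> \<noteq> of_real r"
  using beta_nonreal[OF D] by auto

text \<open>
  The constant term of the characteristic polynomial is \<open>-det A = -1\<close>. Dividing out the root
  \<open>\<alpha>\<close> leaves a real quadratic, whose roots \<open>\<beta>\<close> and its conjugate have product \<open>1/\<alpha>\<close>.
\<close>

lemma eigenvalue_product: "\<alpha> * (cmod \<beta>)\<^sup>2 = 1"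
proof -
  define T1 T2 :: complex where T: "T1 = of_int (inoue_tr1 A)" "T2 = of_int (inoue_tr2 A)"
  define x where "x = complex_of_real \<alpha>"
  define y where "y = cnj \<beta>"
  have ex: "x * (x * x - T1 * x + T2) = 1"
    using arg_cong[OF char_poly_\<alpha>, of complex_of_real] by (simp add: T x_def)
  have eb: "\<beta> * (\<beta> * \<beta> - T1 * \<beta> + T2) = 1"
    using char_poly_\<beta> by (simp add: T)
  have ey: "y * (y * y - T1 * y + T2) = 1"
    using arg_cong[OF char_poly_\<beta>, of cnj] by (simp add: T y_def)
  have ne: "\<beta> - x \<noteq> 0" "y - x \<noteq> 0"
    using beta_neq_real[of \<alpha>] by (auto simp: x_def y_def complex_eq_iff)
  have ne': "\<beta> - y \<noteq> 0"
    using beta_nonreal[OF D] by (auto simp: y_def Reals_cnj_iff)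
  have x0: "x \<noteq> 0" using ex by auto
  have "(\<beta> - x) * (x * (\<beta> * \<beta>) + (x * x - x * T1) * \<beta> + 1) = 0"
    using ex eb by algebra
  then have b: "x * (\<beta> * \<beta>) + (x * x - x * T1) * \<beta> + 1 = 0" using ne by simp
  have "(y - x) * (x * (y * y) + (x * x - x * T1) * y + 1) = 0"
    using ex ey by algebra
  then have y: "x * (y * y) + (x * x - x * T1) * y + 1 = 0" using ne by simp
  have "(\<beta> - y) * (x * (\<beta> * y) - 1) = 0"
    using b y by algebra
  then have "x * (\<beta> * cnj \<beta>) = 1" using ne' by (simp add: y_def)
  then have "complex_of_real (\<alpha> * (cmod \<beta>)\<^sup>2) = 1"
    unfolding of_real_mult complex_norm_square x_def .
  then show ?thesis using of_real_eq_1_iff by blast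
qed

text \<open>
  The value at 1 of the characteristic polynomial \<open>x\<^sup>3 - tr\<^sub>1 x\<^sup>2 + tr\<^sub>2 x - 1\<close> is \<open>tr\<^sub>2 - tr\<^sub>1\<close>. If
  it vanished, \<open>\<alpha>\<close> and \<open>\<beta>\<close> would be roots of the same quadratic with constant term 1, whose roots
  are \<open>\<alpha>\<close> and \<open>1/\<alpha>\<close>, and \<open>\<beta>\<close> would be real.
\<close>

lemma one_not_eigenvalue: "inoue_tr1 A \<noteq> inoue_tr2 A"
proof
  assume eq: "inoue_tr1 A = inoue_tr2 A"
  define T :: complex where "T = of_int (inoue_tr1 A)"
  define x where "x = complex_of_real \<alpha>"
  have "x * (x * x - T * x + T) = 1"
    using arg_cong[OF char_poly_\<alpha>, of complex_of_real] by (simp add: T_def x_def flip: eq)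
  then have "(x - 1) * (x * x + (1 - T) * x + 1) = 0" by algebra
  moreover have "x \<noteq> 1" using alpha_gt_1[OF D] by (simp add: x_def)
  ultimately have x: "x * x + (1 - T) * x + 1 = 0" by simp
  have "\<beta> * (\<beta> * \<beta> - T * \<beta> + T) = 1"
    using char_poly_\<beta> by (simp add: T_def flip: eq)
  then have "(\<beta> - 1) * (\<beta> * \<beta> + (1 - T) * \<beta> + 1) = 0" by algebra
  then have "\<beta> * \<beta> + (1 - T) * \<beta> + 1 = 0" using beta_neq_real[of 1] by simp
  then have "(\<beta> - x) * (x * \<beta> - 1) = 0" using x by algebra
  then have "\<beta> = x \<or> \<beta> = 1 / x" by (auto simp: eq_divide_eq mult.commute)
  then have "\<beta> = of_real \<alpha> \<or> \<beta> = of_real (1 / \<alpha>)" by (simp add: x_def)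
  then show False using beta_neq_real by blast
qed

text \<open>
  The change of \<open>F\<close> under deck transformations is a homomorphism to \<open>\<real>\<close>, hence it does not notice
  conjugation with \<open>(z, w) \<mapsto> (\<beta>z, \<alpha>w)\<close>. Applying it to the characteristic equation
  \<open>M\<^sup>3 = tr\<^sub>1 M\<^sup>2 - tr\<^sub>2 M + 1\<close>, satisfied by the resulting automorphism \<open>M\<close> of the lattice, gives
  \<open>(tr\<^sub>1 - tr\<^sub>2) \<chi> = 0\<close> on the lattice.
\<close>

lemma deck_character:
  assumes \<eta>: "\<And>k s t x v. (s, t) \<in> lat \<Longrightarrow> x \<in> CH \<Longrightarrow> \<eta> (aff k s t x) (daff k v) = \<eta> x v"
    and F: "\<And>x. x \<in> CH \<Longrightarrow> (F has_derivative \<eta> x) (at x)"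
  obtains c :: real where
    "\<And>k s t x. (s, t) \<in> lat \<Longrightarrow> x \<in> CH \<Longrightarrow> F (aff k s t x) = F x + of_int k * c"
proof -
  define p :: "complex \<times> complex" where "p = (0, \<i>)"
  have p: "p \<in> CH" by (simp add: p_def CH_iff)
  define \<kappa> where "\<kappa> k s t = F (aff k s t p) - F p" for k s t
  have mem: "aff k s t x \<in> CH" if "x \<in> CH" for k s t x by (rule inoue_aff_CH[OF D that])
  have \<kappa>: "F (aff k s t x) = F x + \<kappa> k s t" if st: "(s, t) \<in> lat" and x: "x \<in> CH" for k s t x
  proof -
    have "((\<lambda>x. F (aff k s t x) - F x) has_derivative (\<lambda>v. 0)) (at x within CH)" if x: "x \<in> CH" for x
    proof -
      have "((\<lambda>x. F (aff k s t x)) has_derivative (\<lambda>v. \<eta> (aff k s t x) (daff k v))) (at x)"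
        using has_derivative_compose[OF aff_has_derivative F[OF mem[OF x]]] .
      then have "((\<lambda>x. F (aff k s t x)) has_derivative \<eta> x) (at x)"
        by (simp add: \<eta>[OF st x])
      from has_derivative_diff[OF this F[OF x]] show ?thesis
        by (simp add: has_derivative_at_withinI)
    qed
    from has_derivative_zero_constant[OF convex_CH this]
    obtain d where d: "\<And>x. x \<in> CH \<Longrightarrow> F (aff k s t x) - F x = d" by blast
    show ?thesis using d[OF x] d[OF p] by (simp add: \<kappa>_def)
  qed
  have comp: "\<kappa> (k + l) (\<beta> powi k * s' + s) (\<alpha> powi k * t' + t) = \<kappa> k s t + \<kappa> l s' t'"
    if "(s, t) \<in> lat" "(s', t') \<in> lat" for k l s t s' t'
  proof -
    have "F (aff (k + l) (\<beta> powi k * s' + s) (\<alpha> powi k * t' + t) p) = F (aff l s' t' p) + \<kappa> k s t"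
      using \<kappa>[OF that(1) mem[OF p]] by (simp only: inoue_aff_comp[OF D])
    then show ?thesis unfolding \<kappa>_def by simp
  qed
  note l0 = inoue_lattice_0[of a b]
  have add: "\<kappa> 0 (s + s') (t + t') = \<kappa> 0 s t + \<kappa> 0 s' t'" if "(s, t) \<in> lat" "(s', t') \<in> lat" for s t s' t'
    using comp[OF that, of 0 0] by (simp add: add.commute)
  have \<kappa>0: "\<kappa> 0 0 0 = 0" using add[OF l0 l0] by simp
  have conj: "\<kappa> 0 (\<beta> * s) (\<alpha> * t) = \<kappa> 0 s t" if st: "(s, t) \<in> lat" for s t
    using comp[OF l0 st, of 1 0] comp[OF inoue_lattice_mult[OF D st] l0, of 0 1] by simp
  have scale: "\<kappa> 0 (of_int m * s) (of_int m * t) = of_int m * \<kappa> 0 s t" if st: "(s, t) \<in> lat" for m s t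
  proof (induction m rule: int_induct[where k=0])
    case base show ?case by (simp add: \<kappa>0)
  next
    case (step1 i)
    have "(of_int i * s, of_int i * t) \<in> lat" using inoue_lattice_scale[OF st] by simp
    from add[OF this st] step1(2) show ?case by (simp add: distrib_right)
  next
    case (step2 i)
    have "(of_int (i - 1) * s, of_int (i - 1) * t) \<in> lat" using inoue_lattice_scale[OF st, of "i - 1"] by simp
    from add[OF this st] step2(2) show ?case by (simp add: left_diff_distrib)
  qed
  have triv: "\<kappa> 0 s t = 0" if st: "(s, t) \<in> lat" for s t
  proof -
    let ?T1 = "inoue_tr1 A" and ?T2 = "inoue_tr2 A"
    note m1 = inoue_lattice_mult[OF D st] note m2 = inoue_lattice_mult[OF D m1]
    have l1: "(of_int (- ?T2) * (\<beta> * s), of_int (- ?T2) * (\<alpha> * t)) \<in> lat"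
      and l2: "(of_int ?T1 * (\<beta> * (\<beta> * s)), of_int ?T1 * (\<alpha> * (\<alpha> * t))) \<in> lat"
      using inoue_lattice_scale[OF m1, of "- ?T2"] inoue_lattice_scale[OF m2, of ?T1] by simp_all
    have s: "\<beta> * (\<beta> * (\<beta> * s)) = of_int ?T1 * (\<beta> * (\<beta> * s)) + (of_int (- ?T2) * (\<beta> * s) + s)"
      using arg_cong[OF char_poly_\<beta>, of "\<lambda>u. u * s"] by (simp add: algebra_simps)
    have t: "\<alpha> * (\<alpha> * (\<alpha> * t)) = of_int ?T1 * (\<alpha> * (\<alpha> * t)) + (of_int (- ?T2) * (\<alpha> * t) + t)"
      using arg_cong[OF char_poly_\<alpha>, of "\<lambda>u. u * t"] by (simp add: algebra_simps)
    have l12: "(of_int (- ?T2) * (\<beta> * s) + s, of_int (- ?T2) * (\<alpha> * t) + t) \<in> lat"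
      using inoue_lattice_add[OF l1 st] by simp
    have "\<kappa> 0 s t = \<kappa> 0 (\<beta> * (\<beta> * (\<beta> * s))) (\<alpha> * (\<alpha> * (\<alpha> * t)))"
      using conj[OF st] conj[OF m1] conj[OF m2] by simp
    also have "\<dots> = of_int ?T1 * \<kappa> 0 s t + (of_int (- ?T2) * \<kappa> 0 s t + \<kappa> 0 s t)"
      unfolding s t add[OF l2 l12] add[OF l1 st] scale[OF m1] scale[OF m2] conj[OF m1] conj[OF st] ..
    finally have "(of_int ?T1 - of_int ?T2) * \<kappa> 0 s t = 0" unfolding of_int_minus by algebra
    then show ?thesis using one_not_eigenvalue by simp
  qed
  have pow: "\<kappa> k 0 0 = of_int k * \<kappa> 1 0 0" for k
  proof (induction k rule: int_induct[where k=0])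
    case base show ?case by (simp add: \<kappa>0)
  next
    case (step1 i)
    then show ?case using comp[OF l0 l0, of i 1] by (simp add: distrib_right)
  next
    case (step2 i)
    then show ?case using comp[OF l0 l0, of "i - 1" 1] by (simp add: left_diff_distrib)
  qed
  have fin: "\<kappa> k s t = of_int k * \<kappa> 1 0 0" if "(s, t) \<in> lat" for k s t
    using comp[OF that l0, of 0 k] triv[OF that] pow[of k] by simp
  show ?thesis by (rule that[of "\<kappa> 1 0 0"]) (simp add: \<kappa> fin)
qed

text \<open>
  The three pairs \<open>(b\<^sub>i, a\<^sub>i)\<close> are a real basis of \<open>\<complex> \<times> \<real>\<close>, so translates of the
  parallelepiped that they span cover \<open>\<complex> \<times> \<real>\<close>.
\<close>

lemma slab_cocompact:
  assumes "0 < s0"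
  obtains C where "compact C" "C \<subseteq> CH"
    "\<And>x. Im (snd x) \<in> {s0..s1} \<Longrightarrow> \<exists>s t. (s, t) \<in> lat \<and> aff 0 s t x \<in> C"
proof -
  define T :: "real^3 \<Rightarrow> complex \<times> real" where
    "T x = (\<Sum>i\<in>UNIV. of_real (x $ i) * b $ i, \<Sum>i\<in>UNIV. x $ i * a $ i)" for x
  have lin: "linear T"
  proof (rule linearI)
    fix x y show "T (x + y) = T x + T y"
      by (simp add: T_def algebra_simps sum.distrib)
  next
    fix r :: real and x
    have "of_real ((r *\<^sub>R x) $ i) * b $ i = r *\<^sub>R (of_real (x $ i) * b $ i)" for i
      by (simp add: vector_scaleR_component) (simp add: scaleR_conv_of_real)
    moreover have "(r *\<^sub>R x) $ i * a $ i = r *\<^sub>R (x $ i * a $ i)" for i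
      by simp
    ultimately show "T (r *\<^sub>R x) = r *\<^sub>R T x"
      by (simp only: T_def scaleR_Pair scaleR_sum_right)
  qed
  have "inj T"
    unfolding linear_injective_0[OF lin] using eig_indep[OF D] by (auto simp: T_def zero_prod_def)
  have "dim (range T) = dim (UNIV :: (real^3) set)"
    by (rule dim_image_eq[OF lin]) (use \<open>inj T\<close> in simp)
  then have "span (range T) = UNIV" using dim_eq_full[of "range T"] by simp
  moreover have "span (range T) = range T"
    using linear_subspace_image[OF lin subspace_UNIV] by (simp only: span_eq_iff)
  ultimately have surj: "surj T" by simp
  define C where "C = (\<lambda>(y, \<sigma>). (fst (T y), Complex (snd (T y)) \<sigma>)) ` (cbox 0 1 \<times> {s0..s1})"
  have "continuous_on UNIV T" 
    by (rule linear_continuous_on) (rule lin[unfolded linear_conv_bounded_linear])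
  then have cT: "continuous_on S (\<lambda>z. T (fst z))" for S :: "((real^3) \<times> real) set"
    by (rule continuous_on_compose2[OF _ continuous_on_fst[OF continuous_on_id] subset_UNIV])
  have "continuous_on S (\<lambda>z. (fst (T (fst z)), complex_of_real (snd (T (fst z))) + \<i> * of_real (snd z)))" for S
    by (intro continuous_on_Pair continuous_on_add continuous_on_mult continuous_on_const
        continuous_on_of_real continuous_on_fst[OF cT] continuous_on_snd[OF cT] continuous_on_snd continuous_on_id)
  then have "compact C"
    unfolding C_def case_prod_unfold Complex_eq
    by (rule compact_continuous_image) (rule compact_Times[OF compact_cbox compact_Icc])
  moreover have "C \<subseteq> CH" using assms by (auto simp: C_def CH_iff)
  moreover have "\<exists>s t. (s, t) \<in> lat \<and> aff 0 s t x \<in> C" if x: "Im (snd x) \<in> {s0..s1}" for x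
  proof -
    obtain y where y: "T y = (fst x, Re (snd x))" using surj by (metis surjD)
    define n :: "real^3" where "n = (\<chi> i. of_int \<lfloor>y $ i\<rfloor>)"
    have "y - n \<in> cbox 0 1"
      by (auto simp: mem_box_cart n_def floor_less_iff) linarith
    moreover have "T (y - n) = T y - T n" by (rule linear_diff[OF lin])
    moreover have "(- fst (T n), - snd (T n)) \<in> lat"
      unfolding inoue_lattice_def
      by (rule range_eqI[where x="\<chi> i. - \<lfloor>y $ i\<rfloor>"]) (simp add: T_def n_def sum_negf)
    ultimately show ?thesis
      using x unfolding C_def
      by (intro exI[of _ "fst (- T n)"] exI[of _ "snd (- T n)"] conjI image_eqI[of _ _ "(y - n, Im (snd x))"])
        (auto simp: y inoue_aff_0_eq prod_eq_iff complex_eq_iff)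
  qed
  ultimately show ?thesis using that by blast
qed

lemma periodic_bounded:
  fixes f :: "complex \<times> complex \<Rightarrow> real"
  assumes "0 < s0" and f: "continuous_on CH f"
    and per: "\<And>s t x. (s, t) \<in> lat \<Longrightarrow> x \<in> CH \<Longrightarrow> f (aff 0 s t x) = f x"
  shows "\<exists>K. \<forall>x. Im (snd x) \<in> {s0..s1} \<longrightarrow> \<bar>f x\<bar> \<le> K"
proof -
  obtain C where C: "compact C" "C \<subseteq> CH"
    "\<And>x. Im (snd x) \<in> {s0..s1} \<Longrightarrow> \<exists>s t. (s, t) \<in> lat \<and> aff 0 s t x \<in> C"
    by (rule slab_cocompact[OF assms(1)]) blast
  have "bounded (f ` C)"
    using compact_continuous_image[OF continuous_on_subset[OF f C(2)] C(1)] by (rule compact_imp_bounded)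
  then obtain K where K: "\<And>y. y \<in> C \<Longrightarrow> \<bar>f y\<bar> \<le> K" by (auto simp: bounded_iff)
  show ?thesis
  proof (intro exI allI impI)
    fix x :: "complex \<times> complex" assume x: "Im (snd x) \<in> {s0..s1}"
    then obtain s t where st: "(s, t) \<in> lat" "aff 0 s t x \<in> C" using C(3) by blast
    have "x \<in> CH" using x assms(1) by (simp add: CH_iff)
    then show "\<bar>f x\<bar> \<le> K" using K[OF st(2)] per[OF st(1)] by simp
  qed
qed

end

section \<open>The Lee class\<close>

lemma open_upper_half_space: "open CH"
  unfolding CH_def by (intro open_Times open_UNIV open_halfspace_Im_gt)

lemma has_derivative_Im_snd: "((\<lambda>x. Im (snd x)) has_derivative (\<lambda>v. Im (snd v))) F"
  by (intro bounded_linear_imp_has_derivative bounded_linear_compose[OF bounded_linear_Im bounded_linear_snd])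

text \<open>Allowing every exponent and every constant makes the class of functions closed under derivatives.\<close>

lemma smooth_on_power_Im: "smooth_on (\<lambda>x. c * inverse (Im (snd x)) ^ n) CH"
  unfolding smooth_on_def
proof
  fix k
  show "Ck_on k (\<lambda>x. c * inverse (Im (snd x)) ^ n) CH"
  proof (induction k arbitrary: c n)
    case 0
    show ?case by (auto simp: CH_iff intro!: continuous_intros)
  next
    case (Suc k)
    have d: "((\<lambda>x. c * inverse (Im (snd x)) ^ n) has_derivative
        (\<lambda>v. - (c * of_nat n * Im (snd v)) * inverse (Im (snd x)) ^ (n + 1))) (at x)"
      if x: "x \<in> CH" for x
    proof -
      have "((\<lambda>y. c * inverse y ^ n) has_real_derivative - (c * of_nat n) * inverse (Im (snd x)) ^ (n + 1)) (at (Im (snd x)))"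
      proof -
        have "Im (snd x) \<noteq> 0" using x by (simp add: CH_iff)
        from DERIV_cmult[OF DERIV_power[OF DERIV_inverse[OF this], of n], of c]
        show ?thesis by (cases n) (simp_all add: mult_ac power2_eq_square)
      qed
      from has_derivative_compose[OF has_derivative_Im_snd this[unfolded has_field_derivative_def]]
      show ?thesis by (simp add: mult_ac)
    qed
    have "Ck_on k (\<lambda>x. frechet_derivative (\<lambda>x. c * inverse (Im (snd x)) ^ n) (at x) v) CH" for v
      by (rule Ck_on_cong[OF open_upper_half_space Suc.IH[of "- (c * of_nat n * Im (snd v))" "n + 1"]])
        (simp add: frechet_derivative_at[OF d, symmetric])
    moreover have "\<forall>x\<in>CH. (\<lambda>x. c * inverse (Im (snd x)) ^ n) differentiable (at x)"
      by (intro ballI differentiableI[OF d])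
    ultimately show ?case unfolding Ck_on.simps by blast
  qed
qed

context inoue begin

text \<open>
  The comparison of the fluxes of \<open>\<Omega> = e\<^sup>-\<^sup>F \<omega>\<close> through the hypersurfaces \<open>w\<^sub>2 = 1\<close> and
  \<open>w\<^sub>2 = \<alpha>\<^sup>n\<close>. Only the restriction of \<open>\<Omega>\<close> to the real 3-space \<open>w\<^sub>1 = 0\<close> enters, spanned by
  \<open>E1\<close>, \<open>E2\<close>, \<open>E3\<close>, that is by the coordinate directions of \<open>x\<close>, \<open>y\<close> and \<open>w\<^sub>2\<close>. This subspace is
  invariant under \<open>(z, w) \<mapsto> (\<beta>z, \<alpha>w)\<close>.
\<close>

lemma lee_form_multiplier:
  assumes LCK: "LCK_metric atlas g \<eta>"
    and F: "\<And>x. x \<in> CH \<Longrightarrow> (F has_derivative lift \<eta> x) (at x)"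
    and c: "\<And>k s t x. (s, t) \<in> lat \<Longrightarrow> x \<in> CH \<Longrightarrow> F (aff k s t x) = F x + of_int k * c"
  shows "c = ln \<alpha>"
proof -
  have herm: "hermitian_metric atlas g" and closed: "closed_one_form atlas \<eta>"
    using LCK by (simp_all add: LCK_metric_def)
  have g: "bilinear_field atlas g" using herm by (simp add: hermitian_metric_def)
  note h = hermitian_metric_lift[OF herm]
  note \<alpha>1 = alpha_gt_1[OF D]
  define E1 E2 E3 :: "complex \<times> complex" where E: "E1 = (1, 0)" "E2 = (\<i>, 0)" "E3 = (0, \<i>)"
  have JE1: "J E1 = E2" by (simp add: E J_def)
  define \<Omega> where "\<Omega> u v x = exp (- F x) * lift g x (J u) v" for u v x
  define \<Omega>' where "\<Omega>' u v x w = exp (- F x) *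
    (frechet_derivative (\<lambda>y. lift g y (J u) v) (at x) w - lift \<eta> x w * lift g x (J u) v)" for u v x w
  have d\<Omega>: "(\<Omega> u v has_derivative \<Omega>' u v x) (at x)" if x: "x \<in> CH" for u v x
    unfolding \<Omega>_def[abs_def]
    by (rule has_derivative_eq_rhs[OF has_derivative_mult[OF has_derivative_exp[OF has_derivative_minus[OF F[OF x]]]
          smooth_on_has_derivative[OF h(1) x]]])
      (simp add: fun_eq_iff \<Omega>'_def algebra_simps)
  have closed\<Omega>: "\<Omega>' v w x u - \<Omega>' u w x v + \<Omega>' u v x w = 0" if x: "x \<in> CH" for u v w x
  proof -
    have "frechet_derivative (\<lambda>y. lift g y (J v) w) (at x) u
        - frechet_derivative (\<lambda>y. lift g y (J u) w) (at x) v
        + frechet_derivative (\<lambda>y. lift g y (J u) v) (at x) w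
        = lift \<eta> x u * lift g x (J v) w - lift \<eta> x v * lift g x (J u) w + lift \<eta> x w * lift g x (J u) v"
      using LCK_metric_lift[OF LCK x, of u v w] by (simp add: ext_d2_def wedge12_def)
    then show ?thesis unfolding \<Omega>'_def by algebra
  qed
  have c\<Omega>: "continuous_on CH (\<Omega> u v)" for u v
    using d\<Omega> by (meson continuous_at_imp_continuous_on has_derivative_continuous)
  have cF: "continuous_on CH F"
    using F by (meson continuous_at_imp_continuous_on has_derivative_continuous)
  have c\<Omega>': "continuous_on CH (\<lambda>x. \<Omega>' u v x w)" for u v w
    unfolding \<Omega>'_def
    by (intro continuous_intros cF smooth_on_continuous_derivative[OF h(1)] smooth_on_continuous[OF h(1)]
        smooth_on_continuous[OF closed_one_form_lift(2)[OF closed]])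
  have per: "\<Omega> u v (aff 0 s t x) = \<Omega> u v x" if "(s, t) \<in> lat" "x \<in> CH" for u v s t x
    using bilinear_field_lift_invariant[OF g that(2,1), of 0 "J u" v] c[OF that, of 0]
    by (simp add: \<Omega>_def inoue_aff_deriv_0)
  have pos: "\<Omega> E1 E2 x > 0" if "x \<in> CH" for x
    using h(5)[OF that, of E2] by (simp add: \<Omega>_def JE1) (simp add: E zero_prod_def)
  have bdd: "\<exists>K. \<forall>x. Im (snd x) \<in> {1..\<sigma>} \<longrightarrow> \<bar>f x\<bar> \<le> K"
    if "continuous_on CH f" "\<And>s t x. (s, t) \<in> lat \<Longrightarrow> x \<in> CH \<Longrightarrow> f (aff 0 s t x) = f x"
    for f :: "complex \<times> complex \<Rightarrow> real" and \<sigma>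
    using periodic_bounded[OF zero_less_one that] .
  obtain M where M: "\<And>x. Im (snd x) \<in> {1..1} \<Longrightarrow> \<bar>\<Omega> E1 E2 x\<bar> \<le> M"
    using bdd[OF c\<Omega> per] by blast
  have ci: "continuous_on CH (\<lambda>x. inverse (\<Omega> E1 E2 x))"
    using pos by (intro continuous_intros c\<Omega>) force
  have per_inv: "inverse (\<Omega> E1 E2 (aff 0 s t x)) = inverse (\<Omega> E1 E2 x)"
    if "(s, t) \<in> lat" "x \<in> CH" for s t x
    by (simp only: per[OF that])
  obtain m' where m': "\<And>x. Im (snd x) \<in> {1..1} \<Longrightarrow> \<bar>inverse (\<Omega> E1 E2 x)\<bar> \<le> m'"
    using bdd[OF ci per_inv] by blast
  have p1: "x \<in> CH" if "Im (snd x) = 1" for x using that by (simp add: CH_iff)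
  have ImE3: "Im (snd E3) = 1" by (simp add: E)
  have "0 < \<bar>inverse (\<Omega> E1 E2 E3)\<bar>" using pos[OF p1[OF ImE3]] by simp
  also have "\<dots> \<le> m'" by (rule m') (simp add: ImE3)
  finally have m'0: "0 < m'" .
  \<comment> \<open>The lower bound for \<open>\<Omega>\<close> comes from the upper bound for its reciprocal.\<close>
  define m where "m = inverse m'"
  have m0: "0 < m" using m'0 by (simp add: m_def)
  have m: "m \<le> \<Omega> E1 E2 x" if x: "Im (snd x) = 1" for x
  proof -
    have "\<bar>inverse (\<Omega> E1 E2 x)\<bar> \<le> m'" by (rule m') (simp add: x)
    then have "inverse (\<Omega> E1 E2 x) \<le> m'" by (rule abs_le_D1)
    from le_imp_inverse_le[OF this] show ?thesis using pos[OF p1[OF x]] by (simp add: m_def)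
  qed
  define r where "r = \<alpha> * exp (- c)"
  have scaling: "\<Omega> E1 E2 (aff (int n) 0 0 y) = r ^ n * \<Omega> E1 E2 y" if y: "y \<in> CH" for n y
  proof -
    have y': "aff (int n) 0 0 y \<in> CH" by (rule inoue_aff_CH[OF D y])
    have "lift g y E2 E2 = lift g (aff (int n) 0 0 y) (\<beta> ^ n * \<i>, \<beta> ^ n * 0) (\<beta> ^ n * \<i>, \<beta> ^ n * 0)"
      using bilinear_field_lift_invariant[OF g y inoue_lattice_0, of "int n" E2 E2]
      by (simp add: inoue_aff_deriv_def E)
    also have "\<dots> = (cmod (\<beta> ^ n))\<^sup>2 * lift g (aff (int n) 0 0 y) E2 E2"
      unfolding E by (rule hermitian_complex_scaling[OF h(2)[OF y'] h(3)[OF y'] h(4)[OF y']])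
    also have "(cmod (\<beta> ^ n))\<^sup>2 = ((cmod \<beta>)\<^sup>2) ^ n"
      by (simp add: norm_power power_mult[symmetric] mult.commute)
    finally have "\<alpha> ^ n * lift g y E2 E2 = (\<alpha> * (cmod \<beta>)\<^sup>2) ^ n * lift g (aff (int n) 0 0 y) E2 E2"
      by (simp only: power_mult_distrib mult.assoc)
    then have 1: "lift g (aff (int n) 0 0 y) E2 E2 = \<alpha> ^ n * lift g y E2 E2"
      by (simp add: eigenvalue_product)
    have "exp (- F (aff (int n) 0 0 y)) = exp (- F y) * exp (of_nat n * (- c))"
      by (simp add: c[OF inoue_lattice_0 y] flip: exp_add)
    also have "\<dots> = exp (- F y) * exp (- c) ^ n"
      by (simp only: exp_of_nat_mult)
    finally show ?thesis
      by (simp only: \<Omega>_def JE1 1 r_def power_mult_distrib mult_ac)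
  qed
  define pt where "pt x y s = x *\<^sub>R E1 + y *\<^sub>R E2 + s *\<^sub>R E3" for x y s
  have Im_pt: "Im (snd (pt x y s)) = s" for x y s by (simp add: pt_def E)
  \<comment> \<open>The sign \<open>\<epsilon>\<close> yields both inequalities from one comparison: the fluxes of \<open>\<Omega>\<close> and of \<open>-\<Omega>\<close>.\<close>
  have step: "p \<le> q"
    if \<epsilon>: "\<epsilon> = 1 \<or> \<epsilon> = - 1" and top: "\<And>x. Im (snd x) = \<alpha> ^ n \<Longrightarrow> p \<le> \<epsilon> * \<Omega> E1 E2 x"
      and bot: "\<And>x. Im (snd x) = 1 \<Longrightarrow> \<epsilon> * \<Omega> E1 E2 x \<le> q" for \<epsilon> p q n
  proof -
    have CHs: "pt x y s \<in> CH" if "s \<in> {1..\<alpha> ^ n}" for x y s using that by (simp add: CH_iff Im_pt)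
    have along: "((\<lambda>r. \<Omega> u v (f r)) has_real_derivative \<Omega>' u v (f r) e) (at r)"
      if f: "(f has_derivative (\<lambda>h. h *\<^sub>R e)) (at r)" "f r \<in> CH" for u v e r and f :: "real \<Rightarrow> complex \<times> complex"
      unfolding has_field_derivative_def
      by (rule has_derivative_eq_rhs[OF has_derivative_compose[OF f(1) d\<Omega>[OF f(2)]]])
        (simp add: fun_eq_iff linear_cmul[OF has_derivative_linear[OF d\<Omega>[OF f(2)]]])
    have dpt: "((\<lambda>s. pt x y s) has_derivative (\<lambda>h. h *\<^sub>R E3)) (at s)"
      "((\<lambda>x. pt x y s) has_derivative (\<lambda>h. h *\<^sub>R E1)) (at x)"
      "((\<lambda>y. pt x y s) has_derivative (\<lambda>h. h *\<^sub>R E2)) (at y)" for x y s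
      unfolding pt_def by (auto intro!: derivative_eq_intros)
    have cpt: "continuous_on (UNIV \<times> UNIV \<times> {1..\<alpha> ^ n}) (\<lambda>(x, y, s). f (pt x y s))"
      if "continuous_on CH f" for f :: "complex \<times> complex \<Rightarrow> real"
      unfolding case_prod_unfold
      by (rule continuous_on_compose2[OF that]) (auto simp: pt_def intro!: continuous_intros CHs[unfolded pt_def])
    obtain K1 where K1: "\<And>x. Im (snd x) \<in> {1..\<alpha> ^ n} \<Longrightarrow> \<bar>\<Omega> E2 E3 x\<bar> \<le> K1"
      using bdd[OF c\<Omega> per] by blast
    obtain K2 where K2: "\<And>x. Im (snd x) \<in> {1..\<alpha> ^ n} \<Longrightarrow> \<bar>\<Omega> E1 E3 x\<bar> \<le> K2"
      using bdd[OF c\<Omega> per] by blast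
    have abs\<epsilon>: "\<bar>\<epsilon>\<bar> = 1" using \<epsilon> by auto
    show "p \<le> q"
    proof (rule flux_comparison[of 1 "\<alpha> ^ n"
          "\<lambda>x y s. \<epsilon> * \<Omega> E1 E2 (pt x y s)" "\<lambda>x y s. \<epsilon> * \<Omega>' E1 E2 (pt x y s) E3"
          "\<lambda>x y s. - \<epsilon> * \<Omega> E2 E3 (pt x y s)" "\<lambda>x y s. - \<epsilon> * \<Omega>' E2 E3 (pt x y s) E1"
          "\<lambda>x y s. \<epsilon> * \<Omega> E1 E3 (pt x y s)" "\<lambda>x y s. \<epsilon> * \<Omega>' E1 E3 (pt x y s) E2" "max K1 K2"])
      show "1 \<le> \<alpha> ^ n" using \<alpha>1 by simp
      fix x y s :: real
      show "p \<le> \<epsilon> * \<Omega> E1 E2 (pt x y (\<alpha> ^ n))" "\<epsilon> * \<Omega> E1 E2 (pt x y 1) \<le> q"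
        by (intro top bot Im_pt)+
      assume s: "s \<in> {1..\<alpha> ^ n}"
      show "((\<lambda>s. \<epsilon> * \<Omega> E1 E2 (pt x y s)) has_real_derivative \<epsilon> * \<Omega>' E1 E2 (pt x y s) E3) (at s)"
        by (intro DERIV_cmult along dpt CHs s)
      show "((\<lambda>x. - \<epsilon> * \<Omega> E2 E3 (pt x y s)) has_real_derivative - \<epsilon> * \<Omega>' E2 E3 (pt x y s) E1) (at x)"
        by (intro DERIV_cmult along dpt CHs s)
      show "((\<lambda>y. \<epsilon> * \<Omega> E1 E3 (pt x y s)) has_real_derivative \<epsilon> * \<Omega>' E1 E3 (pt x y s) E2) (at y)"
        by (intro DERIV_cmult along dpt CHs s)
      show "\<epsilon> * \<Omega>' E1 E2 (pt x y s) E3 = - \<epsilon> * \<Omega>' E2 E3 (pt x y s) E1 + \<epsilon> * \<Omega>' E1 E3 (pt x y s) E2"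
        using closed\<Omega>[OF CHs[OF s], of E2 E3 x y E1] by algebra
      show "\<bar>- \<epsilon> * \<Omega> E2 E3 (pt x y s)\<bar> \<le> max K1 K2" "\<bar>\<epsilon> * \<Omega> E1 E3 (pt x y s)\<bar> \<le> max K1 K2"
        using K1[of "pt x y s"] K2[of "pt x y s"] s by (auto simp: abs_mult abs\<epsilon> Im_pt)
    qed (intro cpt[of "\<lambda>z. \<epsilon> * \<Omega>' E1 E2 z E3", simplified] cpt continuous_intros c\<Omega> c\<Omega>')+
  qed
  have top: "\<exists>y. Im (snd y) = 1 \<and> \<Omega> E1 E2 x = r ^ n * \<Omega> E1 E2 y" if x: "Im (snd x) = \<alpha> ^ n" for x n
  proof -
    let ?y = "aff (- int n) 0 0 x"
    have Im1: "Im (snd ?y) = 1" using x \<alpha>1 by (simp add: inoue_aff_Im power_int_minus)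
    have "aff (int n) 0 0 ?y = x" by (simp add: inoue_aff_comp[OF D] inoue_aff_0[OF D])
    then have "\<Omega> E1 E2 x = r ^ n * \<Omega> E1 E2 ?y" using scaling[OF p1[OF Im1], of n] by (simp only:)
    then show ?thesis using Im1 by blast
  qed
  have r0: "0 < r" using \<alpha>1 by (simp add: r_def)
  have "m * r ^ n \<le> M" for n
  proof (rule step[of 1 n])
    fix x :: "complex \<times> complex" assume "Im (snd x) = \<alpha> ^ n"
    then obtain y where "Im (snd y) = 1" "\<Omega> E1 E2 x = r ^ n * \<Omega> E1 E2 y" using top by blast
    then show "m * r ^ n \<le> 1 * \<Omega> E1 E2 x" using m[of y] r0 by simp
  next
    fix x :: "complex \<times> complex" assume "Im (snd x) = 1"
    then show "1 * \<Omega> E1 E2 x \<le> M" using M[of x] by simp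
  qed simp
  moreover have "- (M * r ^ n) \<le> - m" for n
  proof (rule step[of "- 1" n])
    fix x :: "complex \<times> complex" assume "Im (snd x) = \<alpha> ^ n"
    then obtain y where "Im (snd y) = 1" "\<Omega> E1 E2 x = r ^ n * \<Omega> E1 E2 y" using top by blast
    then show "- (M * r ^ n) \<le> - 1 * \<Omega> E1 E2 x" using M[of y] r0 by simp
  next
    fix x :: "complex \<times> complex" assume "Im (snd x) = 1"
    then show "- 1 * \<Omega> E1 E2 x \<le> - m" using m[of x] by simp
  qed simp
  ultimately have "r = 1"
    using powers_bounded_imp_one[OF r0 m0, of M] by simp
  then have "\<alpha> = exp c" by (simp add: r_def exp_minus field_simps)
  then show ?thesis by simp
qed

lemma invariant_function_descends:
  assumes "\<And>k s t x. (s, t) \<in> lat \<Longrightarrow> x \<in> CH \<Longrightarrow> f (aff k s t x) = f x"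
  obtains f' where "\<And>x. x \<in> CH \<Longrightarrow> f' (proj x) = f x"
proof (rule that)
  fix x assume x: "x \<in> CH"
  define y where "y = (SOME y. y \<in> CH \<and> proj y = proj x)"
  have y: "y \<in> CH" "proj y = proj x"
    using someI[of "\<lambda>y. y \<in> CH \<and> proj y = proj x" x] x by (auto simp: y_def)
  obtain k s t where "(s, t) \<in> lat" "x = aff k s t y" using proj_eqD[OF D y(2,1) x] .
  then have "f x = f y" using assms y(1) by simp
  then show "f (SOME y. y \<in> CH \<and> proj y = proj x) = f x" by (simp add: y_def)
qed

lemma lee_class_unique:
  assumes LCK: "LCK_metric atlas g \<eta>"
  shows "deRham_class1 atlas \<eta> = deRham_class1 atlas inoue_theta"
proof -
  have closed: "closed_one_form atlas \<eta>" using LCK by (simp add: LCK_metric_def)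
  then have \<eta>: "one_form atlas \<eta>" by (simp add: closed_one_form_def)
  obtain F where F: "\<And>x. x \<in> CH \<Longrightarrow> (F has_derivative lift \<eta> x) (at x)"
    using poincare_convex[OF open_upper_half_space convex_CH closed_one_form_lift[OF closed]] by blast
  obtain c where c: "\<And>k s t x. (s, t) \<in> lat \<Longrightarrow> x \<in> CH \<Longrightarrow> F (aff k s t x) = F x + of_int k * c"
    using deck_character[OF one_form_lift_invariant[OF \<eta>] F] by blast
  have c\<alpha>: "c = ln \<alpha>" using lee_form_multiplier[OF LCK F c] .
  define f where "f x = F x - ln (Im (snd x))" for x
  have "f (aff k s t x) = f x" if "(s, t) \<in> lat" "x \<in> CH" for k s t x
  proof -
    have "0 < \<alpha>" using alpha_gt_1[OF D] by simp
    then have "ln (\<alpha> powi k) = of_int k * ln \<alpha>"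
      by (simp add: ln_powr flip: powr_real_of_int')
    then show ?thesis
      using that(2) \<open>0 < \<alpha>\<close> by (simp add: f_def c[OF that] c\<alpha> inoue_aff_Im ln_mult CH_iff)
  qed
  then obtain f' where f': "\<And>x. x \<in> CH \<Longrightarrow> f' (proj x) = f x" using invariant_function_descends by metis
  have df: "(f has_derivative (\<lambda>v. lift \<eta> x v - Im (snd v) / Im (snd x))) (at x)" if x: "x \<in> CH" for x
  proof -
    have "(ln has_derivative (\<lambda>h. inverse (Im (snd x)) * h)) (at (Im (snd x)))"
      using DERIV_ln[of "Im (snd x)"] x by (simp add: CH_iff has_field_derivative_def)
    from has_derivative_diff[OF F[OF x] has_derivative_compose[OF has_derivative_Im_snd this]]
    show ?thesis unfolding f_def[abs_def] by (simp add: divide_inverse mult.commute)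
  qed
  have "smooth_on (\<lambda>x. lift \<eta> x v + (- 1) * (Im (snd v) * inverse (Im (snd x)) ^ 1)) CH" for v
    by (intro smooth_on_add_scaled open_upper_half_space closed_one_form_lift(2)[OF closed] smooth_on_power_Im)
  then have "smooth_on (\<lambda>x. lift \<eta> x v - Im (snd v) / Im (snd x)) CH" for v
    by (simp add: divide_inverse)
  then have smf: "smooth_on f CH"
    by (intro smooth_onI_derivative[OF open_upper_half_space df])
  have on_chart: "smooth_on (f' \<circ> chart_inv (chart U)) U"
    "x \<in> U \<Longrightarrow> \<eta> (chart U) x v - inoue_theta (chart U) x v = ext_d0 (f' \<circ> chart_inv (chart U)) x v"
    if U: "slice U" for U x v
  proof -
    have U': "open U" "U \<subseteq> CH" using U by (auto simp: inoue_slice_def)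
    have eq: "f y = (f' \<circ> chart_inv (chart U)) y" if "y \<in> U" for y
      using f'[OF subsetD[OF U'(2) that]] by (simp add: inoue_chart_inv[OF U that])
    have "smooth_on f U" using smf U'(2) Ck_on_subset unfolding smooth_on_def by blast
    then show "smooth_on (f' \<circ> chart_inv (chart U)) U" by (rule smooth_on_cong[OF U'(1) _ eq])
    assume x: "x \<in> U"
    have "(f' \<circ> chart_inv (chart U) has_derivative (\<lambda>v. lift \<eta> x v - Im (snd v) / Im (snd x))) (at x)"
      by (rule has_derivative_transform_within_open[OF df U'(1) x eq]) (use x U' in auto)
    then show "\<eta> (chart U) x v - inoue_theta (chart U) x v = ext_d0 (f' \<circ> chart_inv (chart U)) x v"
      by (simp add: ext_d0_def inoue_theta_def one_form_lift_eq[OF \<eta> U x] frechet_derivative_at[symmetric])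
  qed
  show ?thesis
  proof (rule deRham_class1_eqI[of _ f'])
    show "open (chart_range c)" if "c \<in> atlas" for c
      using that by (auto simp: inoue_atlas_iff inoue_chart_range inoue_slice_def)
    show "smooth_function atlas f'"
      using on_chart(1) by (auto simp: smooth_function_def inoue_atlas_iff inoue_chart_range)
    show "\<eta> c x v - inoue_theta c x v = ext_d0 (f' \<circ> chart_inv c) x v"
      if c: "c \<in> atlas" "x \<in> chart_range c" for c x v
    proof -
      obtain U where U: "slice U" "c = chart U" using c(1) inoue_atlas_iff by blast
      then have "x \<in> U" using c(2) inoue_chart_range by blast
      then show ?thesis unfolding U(2) by (rule on_chart(2)[OF U(1)])
    qed
  qed
qed

end

theorem theorem3p11:
  fixes A :: "int^3^3" and \<alpha> :: real and \<beta> :: complex and a :: "real^3" and b :: "complex^3"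
    and g :: "((complex \<times> complex) set, complex \<times> complex) field2"
    and \<theta>\<^sub>1 :: "((complex \<times> complex) set, complex \<times> complex) field1"
  assumes "inoue_data A \<alpha> \<beta> a b"
    and "LCK_metric (inoue_atlas \<alpha> \<beta> a b) g \<theta>\<^sub>1"
  shows "deRham_class1 (inoue_atlas \<alpha> \<beta> a b) \<theta>\<^sub>1 =
         deRham_class1 (inoue_atlas \<alpha> \<beta> a b) inoue_theta"
proof -
  interpret inoue A \<alpha> \<beta> a b using assms(1) by unfold_locales
  show ?thesis using assms(2) by (rule lee_class_unique)
qed

end
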